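(* For $q>0$ and $n\in\mathbb{N}$ let $\Pi_n\sim\mathrm{Mallows}(n,q)$. With respect to the first-order language $\mathsf{TOOB}$ the following holds. (1) [Compton] For $q=1$ the $\mathrm{Mallows}(n,q)$ distribution satisfies the convergence law but not the zero--one law. (2) If $q<1$ is fixed, then $\mathrm{Mallows}(n,q)$ satisfies the zero--one law. (3) If $q>1$ is fixed, then $\mathrm{Mallows}(n,q)$ does not satisfy the convergence law.
   Context: $S_n$ is the set of permutations of $[n]=\{1,\dots,n\}$. For $\pi\in S_n$, $\mathrm{inv}(\pi)=|\{(i,j): i<j,\ \pi(i)>\pi(j)\}|$. For $q>0$, $\Pi_n\sim\mathrm{Mallows}(n,q)$ means $\mathbb{P}(\Pi_n=\pi)=q^{\mathrm{inv}(\pi)}/\sum_{\sigma\in S_n}q^{\mathrm{inv}(\sigma)}$ for all $\pi\in S_n$; for $q=1$ this is the uniform distribution on $S_n$. $\mathsf{TOOB}$ (Theory of One Bijection) is the first-order language (with equality) having a single binary relation symbol $R$. A permutation $\pi\in S_n$ is regarded as the structure with domain $[n]$ in which $R(i,j)$ holds if and only if $\pi(i)=j$; $\pi\models\varphi$ means that this structure satisfies the sentence $\varphi$. The convergence law holds (with respect to $\mathsf{TOOB}$) if $\lim_{n\to\infty}\mathbb{P}(\Pi_n\models\varphi)$ exists for every $\mathsf{TOOB}$ sentence $\varphi$; the zero--one law holds if moreover this limit is either $0$ or $1$ for every such $\varphi$. Part (1) is a result of Compton (1989). *)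

theory Defs
  imports "HOL-Probability.Probability" "HOL-Combinatorics.Permutations"
begin

section \<open>The Mallows distribution\<close>

text \<open>
  A permutation of \<open>{1..n}\<close> is a function \<open>\<pi> :: nat \<Rightarrow> nat\<close> with
  \<^term>\<open>\<pi> permutes {1..n}\<close>; it is the identity outside \<open>{1..n}\<close>, so these functions
  correspond one-to-one to the elements of \<open>S\<^sub>n\<close>.
\<close>

definition inversions :: "nat \<Rightarrow> (nat \<Rightarrow> nat) \<Rightarrow> nat" where
  "inversions n \<pi> = card {(i, j). i \<in> {1..n} \<and> j \<in> {1..n} \<and> i < j \<and> \<pi> i > \<pi> j}"

definition mallows :: "nat \<Rightarrow> real \<Rightarrow> (nat \<Rightarrow> nat) pmf" where
  "mallows n q = embed_pmf (\<lambda>\<pi>. if \<pi> permutes {1..n}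
     then q ^ inversions n \<pi> / (\<Sum>\<sigma> | \<sigma> permutes {1..n}. q ^ inversions n \<sigma>) else 0)"

text \<open>
  \<^const>\<open>embed_pmf\<close> is only meaningful for a genuine probability mass function; this is the
  case for every \<open>q > 0\<close>.
\<close>

lemma pmf_mallows:
  assumes "q > 0"
  shows "pmf (mallows n q) \<pi> = (if \<pi> permutes {1..n}
     then q ^ inversions n \<pi> / (\<Sum>\<sigma> | \<sigma> permutes {1..n}. q ^ inversions n \<sigma>) else 0)"
proof -
  let ?S = "{\<sigma>. \<sigma> permutes {1..n}}"
  define Z where "Z = (\<Sum>\<sigma> | \<sigma> permutes {1..n}. q ^ inversions n \<sigma>)"
  define f where "f = (\<lambda>\<pi>. if \<pi> permutes {1..n} then q ^ inversions n \<pi> / Z else 0)"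
  have fin: "finite ?S"
    by (rule finite_permutations) simp
  have "id \<in> ?S"
    by (simp add: permutes_id)
  then have "?S \<noteq> {}"
    by blast
  then have Z: "Z > 0"
    unfolding Z_def by (intro sum_pos fin zero_less_power assms)
  have nonneg: "f \<pi> \<ge> 0" for \<pi>
    using Z assms by (simp add: f_def)
  have "(\<integral>\<^sup>+ \<pi>. ennreal (f \<pi>) \<partial>count_space UNIV) = (\<Sum>\<pi>\<in>?S. ennreal (f \<pi>))"
    by (rule nn_integral_count_space'[OF fin]) (auto simp: f_def)
  also have "\<dots> = ennreal (\<Sum>\<pi>\<in>?S. f \<pi>)"
    by (rule sum_ennreal) (rule nonneg)
  also have "(\<Sum>\<pi>\<in>?S. f \<pi>) = (\<Sum>\<pi>\<in>?S. q ^ inversions n \<pi>) / Z"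
    by (simp add: f_def sum_divide_distrib)
  also have "\<dots> = 1"
    using Z by (simp add: Z_def)
  finally have "(\<integral>\<^sup>+ \<pi>. ennreal (f \<pi>) \<partial>count_space UNIV) = 1"
    by simp
  then have "pmf (embed_pmf f) \<pi> = f \<pi>"
    by (intro pmf_embed_pmf nonneg)
  then show ?thesis
    unfolding mallows_def f_def Z_def .
qed

section \<open>The first-order language \<open>TOOB\<close>\<close>

text \<open>
  Variables are named by natural numbers. The remaining connectives and the universal quantifier
  are expressible from negation, conjunction and the existential quantifier.
\<close>

datatype toob =
    Eq nat nat
  | Rel nat nat
  | Neg toob
  | Conj toob toob
  | Exists nat toob

primrec free_vars :: "toob \<Rightarrow> nat set" where
  "free_vars (Eq x y) = {x, y}"
| "free_vars (Rel x y) = {x, y}"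
| "free_vars (Neg \<phi>) = free_vars \<phi>"
| "free_vars (Conj \<phi> \<psi>) = free_vars \<phi> \<union> free_vars \<psi>"
| "free_vars (Exists x \<phi>) = free_vars \<phi> - {x}"

definition sentence :: "toob \<Rightarrow> bool" where
  "sentence \<phi> \<longleftrightarrow> free_vars \<phi> = {}"

primrec sat :: "'a set \<Rightarrow> ('a \<Rightarrow> 'a \<Rightarrow> bool) \<Rightarrow> (nat \<Rightarrow> 'a) \<Rightarrow> toob \<Rightarrow> bool" where
  "sat A R v (Eq x y) \<longleftrightarrow> v x = v y"
| "sat A R v (Rel x y) \<longleftrightarrow> R (v x) (v y)"
| "sat A R v (Neg \<phi>) \<longleftrightarrow> \<not> sat A R v \<phi>"
| "sat A R v (Conj \<phi> \<psi>) \<longleftrightarrow> sat A R v \<phi> \<and> sat A R v \<psi>"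
| "sat A R v (Exists x \<phi>) \<longleftrightarrow> (\<exists>a\<in>A. sat A R (v(x := a)) \<phi>)"

lemma sat_cong_free_vars:
  "(\<And>x. x \<in> free_vars \<phi> \<Longrightarrow> v x = w x) \<Longrightarrow> sat A R v \<phi> \<longleftrightarrow> sat A R w \<phi>"
proof (induction \<phi> arbitrary: v w)
  case (Neg \<phi>)
  then have "sat A R v \<phi> \<longleftrightarrow> sat A R w \<phi>"
    by (intro Neg.IH) simp
  then show ?case
    by simp
next
  case (Conj \<phi> \<psi>)
  have "sat A R v \<phi> \<longleftrightarrow> sat A R w \<phi>" "sat A R v \<psi> \<longleftrightarrow> sat A R w \<psi>"
    using Conj.prems by (auto intro!: Conj.IH)
  then show ?case
    by simp
next
  case (Exists x \<phi>)
  have "sat A R (v(x := a)) \<phi> \<longleftrightarrow> sat A R (w(x := a)) \<phi>" for a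
    using Exists.prems by (intro Exists.IH) simp
  then show ?case
    by simp
qed simp_all

text \<open>
  Only used for sentences, whose truth value does not depend on the assignment \<open>v\<close>
  (see \<open>models_iff_sat\<close>).
\<close>

definition models :: "nat \<Rightarrow> (nat \<Rightarrow> nat) \<Rightarrow> toob \<Rightarrow> bool" where
  "models n \<pi> \<phi> \<longleftrightarrow> (\<forall>v. sat {1..n} (\<lambda>i j. \<pi> i = j) v \<phi>)"

lemma models_iff_sat:
  assumes "sentence \<phi>"
  shows "models n \<pi> \<phi> \<longleftrightarrow> sat {1..n} (\<lambda>i j. \<pi> i = j) v \<phi>"
  using assms sat_cong_free_vars[of \<phi> _ v] unfolding models_def sentence_def by blast

section \<open>Convergence law and zero-one law\<close>

text \<open>\<open>P n\<close> is the distribution of the random permutation of \<open>{1..n}\<close>.\<close>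

definition convergence_law :: "(nat \<Rightarrow> (nat \<Rightarrow> nat) pmf) \<Rightarrow> bool" where
  "convergence_law P \<longleftrightarrow>
     (\<forall>\<phi>. sentence \<phi> \<longrightarrow> convergent (\<lambda>n. measure_pmf.prob (P n) {\<pi>. models n \<pi> \<phi>}))"

definition zero_one_law :: "(nat \<Rightarrow> (nat \<Rightarrow> nat) pmf) \<Rightarrow> bool" where
  "zero_one_law P \<longleftrightarrow> convergence_law P \<and>
     (\<forall>\<phi>. sentence \<phi> \<longrightarrow> lim (\<lambda>n. measure_pmf.prob (P n) {\<pi>. models n \<pi> \<phi>}) \<in> {0, 1})"

end

theory Submission
  imports Defs "HOL-Combinatorics.Cycles"
begin

text \<open>
  A permutation is a disjoint union of cycles. An Ehrenfeucht--Fraisse argument shows that the truth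
  of a sentence only depends on the numbers of elements in cycles of length at most some \<open>c\<close>, where
  all large numbers are identified, once there is a cycle longer than \<open>c\<close>.

  For \<open>q = 1\<close>, removing the cycle through a given element yields a recurrence for the probability
  \<open>f\<^sub>n(G)\<close> that the counts of short cycles lie in a set \<open>G\<close>. Its first differences
  \<open>d\<^sub>n\<close> satisfy \<open>(n + 1) |d\<^sub>n| \<le> 2 c max {|d\<^sub>m| : n - c \<le> m < n}\<close>, uniformly in \<open>G\<close>, so \<open>f\<^sub>n(G)\<close> converges.

  For \<open>q < 1\<close>, the weight of the permutations preserving given consecutive intervals factorizes, and
  \<open>(1 - q)\<^sup>n Z\<^sub>n = (1 - q) \<cdots> (1 - q\<^sup>n)\<close> has a positive limit. Hence the events that an
  interval is preserved (and permuted in a prescribed way) are almost independent if the intervals are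
  far apart, and by the second moment method many of them occur. So all short cycle lengths occur arbitrarily often.

  For \<open>q > 1\<close>, the permutation is the reversal composed with a Mallows permutation with parameter \<open>1/q\<close>.
  With high probability the latter preserves a bounded central interval and the parts on
  both sides of it. Then all odd cycles lie in this interval, so the number of elements in short odd cycles is
  bounded and has the parity of \<open>n\<close>, which a sentence can express.
\<close>

section \<open>Elementary equivalence and cycle counts\<close>

text \<open>No limiting distribution is ever identified. For q = 1 the recurrence leads from a set G
  to shifted copies of G, so only an estimate uniform in G closes the induction; the factor n + 1
  then beats the fixed number of earlier increments. For q < 1 the permutation is not coupled to an
  independent process: the probability that one block is preserved is a quotient of values of
  \<open>phi\<close> times a fixed weight, likewise an upper bound for two blocks, and all these
  values are within a factor 1 + \<delta> of their limit once the gaps are long. A lower bound for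
  single blocks and an upper bound for pairs is all that the second moment asks for. For q > 1 the
  sentence must be fixed before n, so parity is tested by listing the even values up to a bound, and
  this bound comes from a central interval whose length is at most D independently of n. The short
  odd cycles are captured by one power: with N the odd part of D!, every odd period up to D divides
  N, and no even period does.\<close>

lemma permutation_of_permutes: "finite A \<Longrightarrow> f permutes A \<Longrightarrow> permutation f"
  by (auto simp: permutation_permutes)

lemma inj_funpow: "f permutes A \<Longrightarrow> (f ^^ i) x = (f ^^ i) y \<longleftrightarrow> x = y"
  by (metis inj_eq inj_fn permutes_inj)

lemma funpow_funpow_commute: "(f ^^ i) ((f ^^ j) x) = (f ^^ j) ((f ^^ i) x)"
proof -
  have "(f ^^ i) ((f ^^ j) x) = (f ^^ (i + j)) x"
    by (simp only: funpow_add comp_apply)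
  also have "i + j = j + i"
    by simp
  also have "(f ^^ (j + i)) x = (f ^^ j) ((f ^^ i) x)"
    by (simp only: funpow_add comp_apply)
  finally show ?thesis .
qed

lemma least_power_funpow:
  assumes "f permutes A"
  shows "least_power f ((f ^^ j) x) = least_power f x"
proof -
  have "(f ^^ n) ((f ^^ j) x) = (f ^^ j) x \<longleftrightarrow> (f ^^ n) x = x" for n
    by (subst funpow_funpow_commute) (rule inj_funpow[OF assms])
  then show ?thesis
    by (simp add: least_power_def)
qed

lemma least_power_pos: "finite A \<Longrightarrow> f permutes A \<Longrightarrow> least_power f x > 0"
  by (rule least_power_of_permutation(2)) (rule permutation_of_permutes)

lemma funpow_least_power: "finite A \<Longrightarrow> f permutes A \<Longrightarrow> (f ^^ least_power f x) x = x"
  by (rule least_power_of_permutation(1)) (rule permutation_of_permutes)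

lemma funpow_eq_self_iff:
  "finite A \<Longrightarrow> f permutes A \<Longrightarrow> (f ^^ n) x = x \<longleftrightarrow> least_power f x dvd n"
  by (simp add: least_power_dvd permutation_of_permutes)

lemma funpow_in: "f permutes A \<Longrightarrow> (f ^^ n) x \<in> A \<longleftrightarrow> x \<in> A"
  by (simp add: permutes_in_image[OF permutes_funpow])

lemma same_orbit_least_power:
  assumes "f permutes A" "(f ^^ i) x = (f ^^ j) y"
  shows "least_power f x = least_power f y"
  by (metis assms least_power_funpow)

text \<open>Powers beyond l need not be compared: l bounds the least power at b, and minimality at a
  excludes anything smaller. This suits relations that see only bounded exponents.\<close>

lemma least_power_eqI:
  assumes "least_power f a = l" "l > 0" "(f ^^ l) a = a" "\<And>k. k \<le> l \<Longrightarrow> (f ^^ k) a = a \<longleftrightarrow> (g ^^ k) b = b"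
  shows "least_power g b = l"
proof -
  have "(g ^^ l) b = b" using assms by simp
  then have "least_power g b \<le> l" "least_power g b > 0" "(g ^^ least_power g b) b = b"
    using least_power_le least_powerI \<open>l > 0\<close> by metis+
  then have "l \<le> least_power g b"
    using assms least_power_le by metis
  then show ?thesis
    using \<open>least_power g b \<le> l\<close> by simp
qed

definition with_period :: "'a set \<Rightarrow> ('a \<Rightarrow> 'a) \<Rightarrow> nat \<Rightarrow> 'a set" where
  "with_period A f l = {x \<in> A. least_power f x = l}"

text \<open>The partial isomorphism of the game: points on a common cycle have the same relative
  positions up to N in both structures. Equations between two forward powers also describe backward
  displacements, and the case x = y records periods up to N.\<close>

definition similar ::
  "nat \<Rightarrow> nat set \<Rightarrow> ('a \<Rightarrow> 'a) \<Rightarrow> ('b \<Rightarrow> 'b) \<Rightarrow> (nat \<Rightarrow> 'a) \<Rightarrow> (nat \<Rightarrow> 'b) \<Rightarrow> bool" where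
  "similar N X f g v w \<longleftrightarrow> (\<forall>x\<in>X. \<forall>y\<in>X. \<forall>i\<le>N. \<forall>j\<le>N.
     (f ^^ i) (v x) = (f ^^ j) (v y) \<longleftrightarrow> (g ^^ i) (w x) = (g ^^ j) (w y))"

lemma similarD:
  "similar N X f g v w \<Longrightarrow> x \<in> X \<Longrightarrow> y \<in> X \<Longrightarrow> i \<le> N \<Longrightarrow> j \<le> N \<Longrightarrow>
     (f ^^ i) (v x) = (f ^^ j) (v y) \<longleftrightarrow> (g ^^ i) (w x) = (g ^^ j) (w y)"
  by (simp add: similar_def)

lemma similar_commute: "similar N X f g v w \<longleftrightarrow> similar N X g f w v"
  by (auto simp: similar_def)

lemma similar_mono: "similar N X f g v w \<Longrightarrow> M \<le> N \<Longrightarrow> Y \<subseteq> X \<Longrightarrow> similar M Y f g v w"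
  unfolding similar_def by (meson order_trans subsetD)

lemma similar_insertI:
  assumes "similar N X f g v w" "z \<notin> X"
    and "\<And>i j. i \<le> N \<Longrightarrow> j \<le> N \<Longrightarrow> (f ^^ i) a = (f ^^ j) a \<longleftrightarrow> (g ^^ i) b = (g ^^ j) b"
    and "\<And>i j x. i \<le> N \<Longrightarrow> j \<le> N \<Longrightarrow> x \<in> X \<Longrightarrow> (f ^^ i) a = (f ^^ j) (v x) \<longleftrightarrow> (g ^^ i) b = (g ^^ j) (w x)"
  shows "similar N (insert z X) f g (v(z := a)) (w(z := b))"
proof -
  have "(f ^^ i) (v x) = (f ^^ j) a \<longleftrightarrow> (g ^^ i) (w x) = (g ^^ j) b" if "i \<le> N" "j \<le> N" "x \<in> X" for i j x
    using assms(4)[of j i x] that by metis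
  then show ?thesis
    using assms unfolding similar_def by (auto simp: fun_upd_def)
qed

text \<open>The ball of radius N around the chosen points, measured along cycles in both
  directions.\<close>

definition nearby :: "nat \<Rightarrow> nat set \<Rightarrow> ('a \<Rightarrow> 'a) \<Rightarrow> (nat \<Rightarrow> 'a) \<Rightarrow> 'a set" where
  "nearby N X f v = {a. \<exists>x\<in>X. \<exists>i\<le>N. \<exists>j\<le>N. (f ^^ i) a = (f ^^ j) (v x)}"

lemma card_nearby:
  assumes "f permutes A" "finite X"
  shows "finite (nearby N X f v)" "card (nearby N X f v) \<le> card X * (N + 1)\<^sup>2"
proof -
  let ?P = "X \<times> {..N} \<times> {..N}"
  let ?F = "\<lambda>(x, i, j). inv (f ^^ i) ((f ^^ j) (v x))"
  have "nearby N X f v \<subseteq> ?F ` ?P"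
  proof
    fix a assume "a \<in> nearby N X f v"
    then obtain x i j where *: "x \<in> X" "i \<le> N" "j \<le> N" "(f ^^ i) a = (f ^^ j) (v x)"
      by (auto simp: nearby_def)
    then have "a = ?F (x, i, j)"
      using permutes_inverses(2)[OF permutes_funpow[OF assms(1)], of i a] by simp
    with * show "a \<in> ?F ` ?P"
      by blast
  qed
  moreover have "finite ?P" "card ?P = card X * (N + 1)\<^sup>2"
    using assms by (auto simp: card_cartesian_product power2_eq_square)
  ultimately show "finite (nearby N X f v)" "card (nearby N X f v) \<le> card X * (N + 1)\<^sup>2"
    by (metis finite_imageI finite_subset, metis surj_card_le)
qed

text \<open>F p determines G p and conversely, which gives a bijection of the images. Applied to the
  orbits of the chosen points, it shows that they cover equally many elements in both
  structures.\<close>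

lemma card_image_same_kernel:
  assumes "finite P" "\<And>p p'. p \<in> P \<Longrightarrow> p' \<in> P \<Longrightarrow> F p = F p' \<longleftrightarrow> G p = G p'"
  shows "card (F ` P) = card (G ` P)"
proof -
  have "bij_betw (\<lambda>y. G (inv_into P F y)) (F ` P) (G ` P)"
  proof (rule bij_betwI')
    fix x y assume xy: "x \<in> F ` P" "y \<in> F ` P"
    then show "(G (inv_into P F x) = G (inv_into P F y)) = (x = y)"
      using assms(2)[of "inv_into P F x" "inv_into P F y"] by (simp add: inv_into_into f_inv_into_f)
  next
    fix x assume "x \<in> F ` P"
    then show "G (inv_into P F x) \<in> G ` P"
      by (simp add: inv_into_into)
  next
    fix y assume "y \<in> G ` P"
    then obtain p where "p \<in> P" "y = G p" by blast
    then show "\<exists>x\<in>F ` P. y = G (inv_into P F x)"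
      using assms(2)[of p "inv_into P F (F p)"] by (metis f_inv_into_f image_eqI inv_into_into)
  qed
  then show ?thesis
    by (rule bij_betw_same_card)
qed

text \<open>A ball of radius N around a point of period l \<le> N is its whole cycle. Hence the
  nearby elements of period l can be counted from equations between powers below l, which
  \<open>similar\<close> preserves.\<close>

lemma nearby_with_period:
  assumes f: "finite A" "f permutes A" and v: "v ` X \<subseteq> A" and l: "l \<le> N"
  shows "with_period A f l \<inter> nearby N X f v =
    (\<lambda>(x, j). (f ^^ j) (v x)) ` {(x, j). x \<in> X \<and> least_power f (v x) = l \<and> j < l}"
proof (intro equalityI subsetI)
  fix a assume "a \<in> with_period A f l \<inter> nearby N X f v"
  then obtain x i j where *: "a \<in> A" "least_power f a = l" "x \<in> X" "(f ^^ i) a = (f ^^ j) (v x)"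
    by (auto simp: nearby_def with_period_def)
  have lx: "least_power f (v x) = l"
    using same_orbit_least_power[OF f(2) *(4)] *(2) by simp
  have "l > 0"
    using least_power_pos[OF f, of a] * by simp
  \<comment> \<open>To undo i steps without an inverse, go on to l * i, a multiple of the period
    that is at least i.\<close>
  have "a = (f ^^ (l * i)) a"
    using funpow_eq_self_iff[OF f, of "l * i" a] * by simp
  also have "l * i = (l * i - i) + i"
    using \<open>l > 0\<close> by simp
  also have "(f ^^ \<dots>) a = (f ^^ (l * i - i)) ((f ^^ i) a)"
    by (simp only: funpow_add comp_apply)
  also have "\<dots> = (f ^^ (l * i - i + j)) (v x)"
    by (simp only: *(4) funpow_add comp_apply)
  also have "\<dots> = (f ^^ ((l * i - i + j) mod l)) (v x)"
    using funpow_mod_eq[of l f "v x"] funpow_least_power[OF f, of "v x"] lx by simp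
  finally have "a = (f ^^ ((l * i - i + j) mod l)) (v x)" .
  then show "a \<in> (\<lambda>(x, j). (f ^^ j) (v x)) ` {(x, j). x \<in> X \<and> least_power f (v x) = l \<and> j < l}"
    using * lx \<open>l > 0\<close> by (intro image_eqI[where x = "(x, (l * i - i + j) mod l)"]) auto
next
  fix a assume "a \<in> (\<lambda>(x, j). (f ^^ j) (v x)) ` {(x, j). x \<in> X \<and> least_power f (v x) = l \<and> j < l}"
  then obtain x j where *: "x \<in> X" "least_power f (v x) = l" "j < l" "a = (f ^^ j) (v x)"
    by auto
  then have "a \<in> A"
    using v funpow_in[OF f(2)] by auto
  moreover have "least_power f a = l"
    using * least_power_funpow[OF f(2)] by simp
  moreover have "a \<in> nearby N X f v"
  proof -
    have "(f ^^ 0) a = (f ^^ j) (v x)" "j \<le> N"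
      using * l by auto
    with *(1) show ?thesis
      unfolding nearby_def by blast
  qed
  ultimately show "a \<in> with_period A f l \<inter> nearby N X f v"
    by (simp add: with_period_def)
qed

text \<open>The long cycles may have different lengths. They provide the answers to far moves on
  cycles longer than the current radius.\<close>

definition matching :: "nat \<Rightarrow> 'a set \<Rightarrow> ('a \<Rightarrow> 'a) \<Rightarrow> 'b set \<Rightarrow> ('b \<Rightarrow> 'b) \<Rightarrow> bool" where
  "matching c A f B g \<longleftrightarrow>
     (\<forall>l\<in>{1..c}. card (with_period A f l) = card (with_period B g l) \<or>
        c \<le> card (with_period A f l) \<and> c \<le> card (with_period B g l)) \<and>
     (\<exists>a\<in>A. c < least_power f a) \<and> (\<exists>b\<in>B. c < least_power g b)"

lemma matching_commute: "matching c A f B g \<longleftrightarrow> matching c B g A f"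
  by (auto simp: matching_def)

lemma long_orbit_meets_outside:
  assumes g: "finite B" "g permutes B" and b: "b \<in> B" "card S < least_power g b" and S: "finite S"
  obtains b' where "b' \<in> B" "b' \<notin> S" "least_power g b' = least_power g b"
proof -
  let ?O = "set (support g b)"
  have "card ?O = least_power g b"
    using distinct_card[OF cycle_of_permutation[OF permutation_of_permutes[OF g]], of b] by simp
  then have "\<not> ?O \<subseteq> S"
    using b S card_mono[of S ?O] by auto
  then obtain j where "(g ^^ j) b \<notin> S"
    by auto
  then show ?thesis
    using that[of "(g ^^ j) b"] b by (simp add: funpow_in[OF g(2)] least_power_funpow[OF g(2)])
qed

text \<open>The answer to a move far from all chosen points. If the period l is at most N, equally
  many elements of period l are nearby on both sides, so the matching counts leave a free one. If l
  > N, a cycle longer than c cannot be covered by fewer than c nearby points, and powers up to N do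
  not see its length.\<close>

lemma far_extension:
  fixes A :: "'a set" and B :: "'b set"
  assumes f: "finite A" "f permutes A" and g: "finite B" "g permutes B"
    and X: "finite X" "v ` X \<subseteq> A" "w ` X \<subseteq> B"
    and sim: "similar N X f g v w" and match: "matching c A f B g"
    and c: "card X * (N + 1)\<^sup>2 < c" "N \<le> c"
    and a: "a \<in> A" "a \<notin> nearby N X f v"
  obtains b where "b \<in> B" "b \<notin> nearby N X g w"
    "\<And>i j. i \<le> N \<Longrightarrow> j \<le> N \<Longrightarrow> (f ^^ i) a = (f ^^ j) a \<longleftrightarrow> (g ^^ i) b = (g ^^ j) b"
proof -
  define l where "l = least_power f a"
  have "l > 0"
    using least_power_pos[OF f] by (simp add: l_def)
  have small: "card (nearby N X g w) < c" "finite (nearby N X g w)"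
    using card_nearby[OF g(2) X(1), of N w] c by auto
  have "\<exists>b. b \<in> B \<and> b \<notin> nearby N X g w \<and> (least_power g b = l \<or> N < l \<and> N < least_power g b)"
  proof (cases "l \<le> N")
    case False
    obtain b where "b \<in> B" "c < least_power g b"
      using match by (auto simp: matching_def)
    then obtain b' where "b' \<in> B" "b' \<notin> nearby N X g w" "least_power g b' = least_power g b"
      using long_orbit_meets_outside[OF g, of b "nearby N X g w"] small by auto
    then show ?thesis
      using False c \<open>c < least_power g b\<close> by (intro exI[of _ b']) auto
  next
    case True
    have fin: "finite (with_period A f l)" "finite (with_period B g l)"
      using f g by (auto simp: with_period_def)
    have per: "least_power f (v x) = l \<longleftrightarrow> least_power g (w x) = l" if "x \<in> X" for x
    proof -
      have *: "(f ^^ k) (v x) = v x \<longleftrightarrow> (g ^^ k) (w x) = w x" if "k \<le> l" for k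
        using similarD[OF sim \<open>x \<in> X\<close> \<open>x \<in> X\<close>, of k 0] that True by simp
      show ?thesis
      proof
        assume "least_power f (v x) = l"
        then show "least_power g (w x) = l"
          using \<open>l > 0\<close> funpow_least_power[OF f, of "v x"] *
          by (intro least_power_eqI[of f "v x" l g "w x"]) metis+
      next
        assume "least_power g (w x) = l"
        then show "least_power f (v x) = l"
          using \<open>l > 0\<close> funpow_least_power[OF g, of "w x"] *
          by (intro least_power_eqI[of g "w x" l f "v x"]) metis+
      qed
    qed
    let ?P = "{(x, j). x \<in> X \<and> least_power f (v x) = l \<and> j < l}"
    have P: "?P = {(x, j). x \<in> X \<and> least_power g (w x) = l \<and> j < l}"
      using per by auto
    have "?P \<subseteq> X \<times> {..<l}" by auto
    then have "finite ?P"
      using X(1) by (meson finite_SigmaI finite_lessThan finite_subset)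
    have "card ((\<lambda>(x, j). (f ^^ j) (v x)) ` ?P) = card ((\<lambda>(x, j). (g ^^ j) (w x)) ` ?P)"
      by (rule card_image_same_kernel[OF \<open>finite ?P\<close>]) (use True similarD[OF sim] in auto)
    then have card_eq: "card (with_period A f l \<inter> nearby N X f v) = card (with_period B g l \<inter> nearby N X g w)"
      unfolding nearby_with_period[OF f X(2) True] nearby_with_period[OF g X(3) True] P .
    have "card (with_period A f l \<inter> nearby N X f v) < card (with_period A f l)"
      using fin a by (intro psubset_card_mono) (auto simp: with_period_def l_def)
    moreover have "card (with_period B g l \<inter> nearby N X g w) < c"
      using small by (meson card_mono inf_le2 le_less_trans)
    moreover have mt: "card (with_period A f l) = card (with_period B g l) \<or> c \<le> card (with_period B g l)"
      using match True c(2) \<open>l > 0\<close> unfolding matching_def by (metis Suc_leI One_nat_def atLeastAtMost_iff le_trans)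
    ultimately have "card (with_period B g l \<inter> nearby N X g w) < card (with_period B g l)"
      using card_eq mt by linarith
    then obtain b where "b \<in> with_period B g l" "b \<notin> nearby N X g w"
      by (cases "with_period B g l \<subseteq> nearby N X g w") (auto simp: Int_absorb2)
    then show ?thesis
      by (auto simp: with_period_def)
  qed
  then obtain b where b: "b \<in> B" "b \<notin> nearby N X g w"
      "least_power g b = l \<or> N < l \<and> N < least_power g b"
    by blast
  \<comment> \<open>If the periods differ, both exceed N, so the only k \<le> N divisible by either
    of them is 0.\<close>
  have dvd: "l dvd k \<longleftrightarrow> least_power g b dvd k" if "k \<le> N" for k
    using b(3) that \<open>l > 0\<close> by (cases "k = 0") (auto dest: dvd_imp_le)
  have pow_eq: "(h ^^ i) x = (h ^^ j) x \<longleftrightarrow> least_power h x dvd (j - i)"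
    if "finite C" "h permutes C" "i \<le> j" for h :: "'c \<Rightarrow> 'c" and C x i j
  proof -
    have "(h ^^ j) x = (h ^^ i) ((h ^^ (j - i)) x)"
      using that by (metis comp_apply funpow_add le_add_diff_inverse)
    then show ?thesis
      using inj_funpow[OF that(2), of i x "(h ^^ (j - i)) x"] funpow_eq_self_iff[OF that(1,2)] by metis
  qed
  have "(f ^^ i) a = (f ^^ j) a \<longleftrightarrow> (g ^^ i) b = (g ^^ j) b" if "i \<le> N" "j \<le> N" for i j
  proof (cases "i \<le> j")
    case True
    then show ?thesis
      using pow_eq[OF f True] pow_eq[OF g True] dvd[of "j - i"] that l_def by simp
  next
    case False
    then have "j \<le> i" by simp
    then show ?thesis
      using pow_eq[OF f \<open>j \<le> i\<close>, of a] pow_eq[OF g \<open>j \<le> i\<close>, of b] dvd[of "i - j"] that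
      unfolding l_def eq_commute[of "(f ^^ i) a"] eq_commute[of "(g ^^ i) b"] by simp
  qed
  with b show ?thesis
    using that by blast
qed

text \<open>Each move halves the radius. A move near v x is answered by the point in the same
  position relative to w x; comparing it with other points shifts the exponents by at most N, which
  is why similarity is assumed up to 2 * N.\<close>

lemma similar_extension:
  assumes f: "finite A" "f permutes A" and g: "finite B" "g permutes B"
    and X: "finite X" "v ` X \<subseteq> A" "w ` X \<subseteq> B" "z \<notin> X"
    and sim: "similar (2 * N) X f g v w" and match: "matching c A f B g"
    and c: "card X * (N + 1)\<^sup>2 < c" "N \<le> c"
    and a: "a \<in> A"
  obtains b where "b \<in> B" "similar N (insert z X) f g (v(z := a)) (w(z := b))"
proof (cases "a \<in> nearby N X f v")
  case False
  have sim': "similar N X f g v w"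
    using sim by (rule similar_mono) auto
  obtain b where b: "b \<in> B" "b \<notin> nearby N X g w"
    "\<And>i j. i \<le> N \<Longrightarrow> j \<le> N \<Longrightarrow> (f ^^ i) a = (f ^^ j) a \<longleftrightarrow> (g ^^ i) b = (g ^^ j) b"
    using far_extension[OF f g X(1-3) sim' match c a False] by blast
  have "similar N (insert z X) f g (v(z := a)) (w(z := b))"
    using sim' X(4) b(3) by (rule similar_insertI) (use b(2) False in \<open>auto simp: nearby_def\<close>)
  with b(1) show ?thesis
    by (rule that)
next
  case True
  then obtain x i j where x: "x \<in> X" "i \<le> N" "j \<le> N" "(f ^^ i) a = (f ^^ j) (v x)"
    by (auto simp: nearby_def)
  define b where "b = inv (g ^^ i) ((g ^^ j) (w x))"
  have gb: "(g ^^ i) b = (g ^^ j) (w x)"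
    unfolding b_def by (rule permutes_inverses(1)[OF permutes_funpow[OF g(2)]])
  have "b \<in> B"
    using gb X(3) x(1) funpow_in[OF g(2)] by (metis image_subset_iff)
  have shift: "(f ^^ (k + i)) a = (f ^^ (k + j)) (v x)" "(g ^^ (k + i)) b = (g ^^ (k + j)) (w x)" for k
    by (simp_all only: funpow_add comp_apply x(4) gb)
  have canc: "(h ^^ k) s = (h ^^ l) t \<longleftrightarrow> (h ^^ (k + i)) s = (h ^^ (l + i)) t"
    if "h permutes C" for h :: "'c \<Rightarrow> 'c" and C k l s t
    using inj_funpow[OF that, of i "(h ^^ k) s" "(h ^^ l) t"]
    by (simp add: funpow_funpow_commute[of i] funpow_add)
  have "similar N (insert z X) f g (v(z := a)) (w(z := b))"
  proof (rule similar_insertI)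
    show "similar N X f g v w"
      using sim by (rule similar_mono) auto
    show "(f ^^ k) a = (f ^^ l) a \<longleftrightarrow> (g ^^ k) b = (g ^^ l) b" if "k \<le> N" "l \<le> N" for k l
      using canc[OF f(2), of k a l a] canc[OF g(2), of k b l b]
        similarD[OF sim x(1) x(1), of "k + j" "l + j"] that x by (simp add: shift)
    show "(f ^^ k) a = (f ^^ l) (v y) \<longleftrightarrow> (g ^^ k) b = (g ^^ l) (w y)"
      if "k \<le> N" "l \<le> N" "y \<in> X" for k l y
      using canc[OF f(2), of k a l "v y"] canc[OF g(2), of k b l "w y"]
        similarD[OF sim x(1) that(3), of "k + j" "l + i"] that x by (simp add: shift)
  qed (rule X(4))
  with \<open>b \<in> B\<close> show ?thesis
    by (rule that)
qed

section \<open>The induction over formulas\<close>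

primrec quantifier_depth :: "toob \<Rightarrow> nat" where
  "quantifier_depth (Eq x y) = 0"
| "quantifier_depth (Rel x y) = 0"
| "quantifier_depth (Neg \<phi>) = quantifier_depth \<phi>"
| "quantifier_depth (Conj \<phi> \<psi>) = max (quantifier_depth \<phi>) (quantifier_depth \<psi>)"
| "quantifier_depth (Exists x \<phi>) = Suc (quantifier_depth \<phi>)"

text \<open>The radius is halved by each quantifier and stays at least 1, enough for one application
  of the relation. Depth plus number of chosen points never exceeds m, so every ball that occurs has
  at most \<open>m * (2 ^ m + 1)\<^sup>2\<close> points, fewer than c.\<close>

lemma sat_similar:
  assumes f: "finite A" "f permutes A" and g: "finite B" "g permutes B"
    and match: "matching c A f B g" and c: "m * (2 ^ m + 1)\<^sup>2 < c"
  shows "finite X \<Longrightarrow> v ` X \<subseteq> A \<Longrightarrow> w ` X \<subseteq> B \<Longrightarrow> free_vars \<phi> \<subseteq> X \<Longrightarrow>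
    quantifier_depth \<phi> + card X \<le> m \<Longrightarrow> similar (2 ^ quantifier_depth \<phi>) X f g v w \<Longrightarrow>
    sat A (\<lambda>i j. f i = j) v \<phi> \<longleftrightarrow> sat B (\<lambda>i j. g i = j) w \<phi>"
proof (induction \<phi> arbitrary: X v w)
  case (Eq x y)
  then show ?case
    using similarD[OF Eq.prems(6), of x y 0 0] by simp
next
  case (Rel x y)
  then show ?case
    using similarD[OF Rel.prems(6), of x y 1 0] by simp
next
  case (Neg \<phi>)
  then show ?case
    using Neg.IH[of X v w] by simp
next
  case (Conj \<phi> \<psi>)
  have "similar (2 ^ quantifier_depth \<phi>) X f g v w" "similar (2 ^ quantifier_depth \<psi>) X f g v w"
    by (rule similar_mono[OF Conj.prems(6)]; simp)+
  then show ?case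
    using Conj.IH(1)[of X v w] Conj.IH(2)[of X v w] Conj.prems by simp
next
  case (Exists z \<phi>)
  \<comment> \<open>A variable that is quantified again gives up its old value.\<close>
  define Y where "Y = X - {z}"
  let ?N = "2 ^ quantifier_depth \<phi> :: nat"
  have Y: "finite Y" "v ` Y \<subseteq> A" "w ` Y \<subseteq> B" "z \<notin> Y"
    using Exists.prems by (auto simp: Y_def)
  have fv: "free_vars \<phi> \<subseteq> insert z Y"
    using Exists.prems(4) by (auto simp: Y_def)
  have sim: "similar (2 * ?N) Y f g v w"
    using Exists.prems(6) by (rule similar_mono) (auto simp: Y_def)
  have "card Y \<le> card X"
    unfolding Y_def by (intro card_mono) (use Exists.prems(1) in auto)
  then have card: "quantifier_depth \<phi> + card (insert z Y) \<le> m"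
    using Exists.prems(1,5) Y by simp
  have "?N \<le> 2 ^ m"
    using card by (intro power_increasing) auto
  then have "card Y * (?N + 1)\<^sup>2 \<le> m * (2 ^ m + 1)\<^sup>2"
    using card Y by (intro mult_mono power_mono) auto
  with c have c1: "card Y * (?N + 1)\<^sup>2 < c" by simp
  have "m \<ge> 1" using Exists.prems(5) by simp
  have "?N \<le> 2 ^ m + 1" using \<open>?N \<le> 2 ^ m\<close> by linarith
  also have "\<dots> \<le> (2 ^ m + 1)\<^sup>2" by (simp add: power2_eq_square)
  also have "\<dots> \<le> m * (2 ^ m + 1)\<^sup>2" using \<open>m \<ge> 1\<close> by simp
  finally have c2: "?N \<le> c" using c by simp
  have IH: "sat A (\<lambda>i j. f i = j) (v(z := a)) \<phi> \<longleftrightarrow> sat B (\<lambda>i j. g i = j) (w(z := b)) \<phi>"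
    if "a \<in> A" "b \<in> B" "similar ?N (insert z Y) f g (v(z := a)) (w(z := b))" for a b
  proof (rule Exists.IH[OF _ _ _ fv card that(3)])
    show "(v(z := a)) ` insert z Y \<subseteq> A" "(w(z := b)) ` insert z Y \<subseteq> B"
      using Y that(1,2) by auto
  qed (use Y(1) in simp)
  show ?case
  proof
    assume "sat A (\<lambda>i j. f i = j) v (Exists z \<phi>)"
    then obtain a where a: "a \<in> A" "sat A (\<lambda>i j. f i = j) (v(z := a)) \<phi>"
      by auto
    obtain b where "b \<in> B" "similar ?N (insert z Y) f g (v(z := a)) (w(z := b))"
      using similar_extension[OF f g Y sim match c1 c2 a(1)] .
    then show "sat B (\<lambda>i j. g i = j) w (Exists z \<phi>)"
      using IH a by auto
  next
    assume "sat B (\<lambda>i j. g i = j) w (Exists z \<phi>)"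
    then obtain b where b: "b \<in> B" "sat B (\<lambda>i j. g i = j) (w(z := b)) \<phi>"
      by auto
    obtain a where "a \<in> A" "similar ?N (insert z Y) g f (w(z := b)) (v(z := a))"
      using similar_extension[OF g f Y(1,3,2,4) similar_commute[THEN iffD1, OF sim]
          matching_commute[THEN iffD1, OF match] c1 c2 b(1)] .
    then show "sat A (\<lambda>i j. f i = j) v (Exists z \<phi>)"
      using IH[of a b] b similar_commute[of ?N "insert z Y" f] by auto
  qed
qed

text \<open>Before any variable is assigned the similarity is vacuous, so the threshold depends only
  on the quantifier depth.\<close>

lemma models_matching:
  assumes "sentence \<phi>"
  obtains c where "\<And>n \<pi> m \<sigma>. \<lbrakk>\<pi> permutes {1..n}; \<sigma> permutes {1..m}; matching c {1..n} \<pi> {1..m} \<sigma>\<rbrakk>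
    \<Longrightarrow> models n \<pi> \<phi> \<longleftrightarrow> models m \<sigma> \<phi>"
proof
  fix n m :: nat and \<pi> \<sigma> :: "nat \<Rightarrow> nat"
  let ?d = "quantifier_depth \<phi>"
  assume "\<pi> permutes {1..n}" "\<sigma> permutes {1..m}"
    "matching (Suc (?d * (2 ^ ?d + 1)\<^sup>2)) {1..n} \<pi> {1..m} \<sigma>"
  then have "sat {1..n} (\<lambda>i j. \<pi> i = j) id \<phi> \<longleftrightarrow> sat {1..m} (\<lambda>i j. \<sigma> i = j) id \<phi>"
    using assms by (intro sat_similar[where X = "{}"]) (auto simp: sentence_def similar_def)
  then show "models n \<pi> \<phi> \<longleftrightarrow> models m \<sigma> \<phi>"
    using models_iff_sat[OF assms] by blast
qed

section \<open>The cycle counts of a uniform permutation\<close>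

lemma funpow_cong_on:
  assumes "\<And>y. y \<in> S \<Longrightarrow> f y = g y" "\<And>y. y \<in> S \<Longrightarrow> g y \<in> S" "y \<in> S"
  shows "(f ^^ i) y = (g ^^ i) y"
proof -
  have "(f ^^ i) y = (g ^^ i) y \<and> (g ^^ i) y \<in> S"
    by (induction i) (use assms in auto)
  then show ?thesis ..
qed

lemma least_power_cong_on:
  assumes "\<And>y. y \<in> S \<Longrightarrow> f y = g y" "\<And>y. y \<in> S \<Longrightarrow> g y \<in> S" "y \<in> S"
  shows "least_power f y = least_power g y"
  unfolding least_power_def using funpow_cong_on[of S f g y] assms by simp

lemma funpow_cycle_of_list_nth:
  assumes "distinct xs" "i < length xs"
  shows "(cycle_of_list xs ^^ n) (xs ! i) = xs ! ((n + i) mod length xs)"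
proof -
  have "(cycle_of_list xs ^^ n) (xs ! i) = map (cycle_of_list xs ^^ n) xs ! i"
    using assms(2) by simp
  also have "\<dots> = xs ! ((n + i) mod length xs)"
    using assms by (simp only: cyclic_rotation nth_rotate)
  finally show ?thesis .
qed

lemma least_power_cycle_of_list:
  assumes "distinct xs" "y \<in> set xs"
  shows "least_power (cycle_of_list xs) y = length xs"
proof -
  obtain i where i: "i < length xs" "y = xs ! i"
    using assms(2) by (metis in_set_conv_nth)
  have "(cycle_of_list xs ^^ n) y = y \<longleftrightarrow> length xs dvd n" for n
  proof -
    have "(cycle_of_list xs ^^ n) y = y \<longleftrightarrow> (n + i) mod length xs = i"
      using i assms(1) nth_eq_iff_index_eq[OF assms(1), of "(n + i) mod length xs" i]
      by (simp add: funpow_cycle_of_list_nth mod_less_divisor[OF length_pos_if_in_set[OF assms(2)]])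
    also have "\<dots> \<longleftrightarrow> (n + i) mod length xs = i mod length xs"
      using i by simp
    also have "\<dots> \<longleftrightarrow> length xs dvd n"
      using mod_eq_dvd_iff_nat[of i "n + i" "length xs"] by simp
    finally show ?thesis .
  qed
  then show ?thesis
    unfolding least_power_def using i by (intro Least_equality) (auto dest: dvd_imp_le)
qed

context
  fixes xs :: "'a list" and B :: "'a set" and \<sigma> :: "'a \<Rightarrow> 'a"
  assumes xs: "distinct xs" and disj: "set xs \<inter> B = {}" and \<sigma>: "\<sigma> permutes B"
begin

lemma cycle_comp_permutes: "cycle_of_list xs \<circ> \<sigma> permutes set xs \<union> B"
proof (rule permutes_compose)
  show "\<sigma> permutes set xs \<union> B"
    using \<sigma> by (rule permutes_subset) auto
  show "cycle_of_list xs permutes set xs \<union> B"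
    by (rule permutes_subset[OF cycle_permutes]) auto
qed

lemma cycle_comp_apply_cycle: "y \<in> set xs \<Longrightarrow> (cycle_of_list xs \<circ> \<sigma>) y = cycle_of_list xs y"
  using disj permutes_not_in[OF \<sigma>, of y] by (auto simp: disjoint_iff)

lemma cycle_comp_apply_rest: "y \<in> B \<Longrightarrow> (cycle_of_list xs \<circ> \<sigma>) y = \<sigma> y"
  using disj permutes_in_image[OF \<sigma>] id_outside_supp[of "\<sigma> y" xs] by auto

lemma least_power_cycle_comp:
  "y \<in> set xs \<Longrightarrow> least_power (cycle_of_list xs \<circ> \<sigma>) y = length xs"
  "y \<in> B \<Longrightarrow> least_power (cycle_of_list xs \<circ> \<sigma>) y = least_power \<sigma> y"
proof -
  assume y: "y \<in> set xs"
  have "least_power (cycle_of_list xs \<circ> \<sigma>) y = least_power (cycle_of_list xs) y"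
    by (rule least_power_cong_on[OF cycle_comp_apply_cycle _ y])
      (simp_all add: permutes_in_image[OF cycle_permutes])
  then show "least_power (cycle_of_list xs \<circ> \<sigma>) y = length xs"
    using y xs by (simp add: least_power_cycle_of_list)
next
  assume y: "y \<in> B"
  show "least_power (cycle_of_list xs \<circ> \<sigma>) y = least_power \<sigma> y"
    by (rule least_power_cong_on[OF cycle_comp_apply_rest _ y])
      (use permutes_in_image[OF \<sigma>] in auto)
qed

text \<open>The list is recovered from the composition and its first point, which makes the
  decomposition along the cycle through x unique.\<close>

lemma support_cycle_comp:
  assumes "xs = x # ys"
  shows "support (cycle_of_list xs \<circ> \<sigma>) x = xs"
proof (rule nth_equalityI)
  have len: "least_power (cycle_of_list xs \<circ> \<sigma>) x = length xs"
    using assms by (intro least_power_cycle_comp) simp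
  then show "length (support (cycle_of_list xs \<circ> \<sigma>) x) = length xs"
    by simp
  fix i assume "i < length (support (cycle_of_list xs \<circ> \<sigma>) x)"
  then have i: "i < length xs"
    using len by simp
  have x: "x = xs ! 0" "x \<in> set xs"
    using assms by auto
  have "((cycle_of_list xs \<circ> \<sigma>) ^^ i) x = (cycle_of_list xs ^^ i) x"
    by (rule funpow_cong_on[OF cycle_comp_apply_cycle _ x(2)])
      (simp_all add: permutes_in_image[OF cycle_permutes])
  also have "\<dots> = xs ! i"
    using i xs funpow_cycle_of_list_nth[of xs 0 i] x(1) by fastforce
  finally show "support (cycle_of_list xs \<circ> \<sigma>) x ! i = xs ! i"
    using i len by simp
qed

lemma with_period_cycle_comp:
  "with_period (set xs \<union> B) (cycle_of_list xs \<circ> \<sigma>) l =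
     (if l = length xs then set xs else {}) \<union> with_period B \<sigma> l"
  using least_power_cycle_comp by (auto simp: with_period_def)

end

text \<open>
  Counts elements in cycles of length \<open>l\<close>, not cycles: each such cycle contributes \<open>l\<close>.
\<close>

definition profile :: "nat \<Rightarrow> 'a set \<Rightarrow> ('a \<Rightarrow> 'a) \<Rightarrow> nat \<Rightarrow> nat" where
  "profile M A f = (\<lambda>l. if 1 \<le> l \<and> l \<le> M then card (with_period A f l) else 0)"

text \<open>The condition left for the other cycles once a cycle of length k is known to be
  present.\<close>

definition remove_cycle :: "nat \<Rightarrow> nat \<Rightarrow> (nat \<Rightarrow> nat) set \<Rightarrow> (nat \<Rightarrow> nat) set" where
  "remove_cycle M k G = {h. (\<lambda>l. h l + (if l = k \<and> k \<le> M then k else 0)) \<in> G}"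

lemma remove_cycle_large: "k > M \<Longrightarrow> remove_cycle M k G = G"
  by (simp add: remove_cycle_def)

lemma profile_cycle_comp:
  assumes "distinct xs" "xs \<noteq> []" "set xs \<inter> B = {}" "\<sigma> permutes B" "finite B"
  shows "profile M (set xs \<union> B) (cycle_of_list xs \<circ> \<sigma>) \<in> G \<longleftrightarrow> profile M B \<sigma> \<in> remove_cycle M (length xs) G"
proof -
  have "card (with_period (set xs \<union> B) (cycle_of_list xs \<circ> \<sigma>) l) =
      card (with_period B \<sigma> l) + (if l = length xs then length xs else 0)" for l
  proof -
    have "set xs \<inter> with_period B \<sigma> l = {}" "finite (with_period B \<sigma> l)"
      using assms by (auto simp: with_period_def)
    then show ?thesis
      unfolding with_period_cycle_comp[OF assms(1,3,4)]
      using assms(1) by (cases "l = length xs") (simp_all add: card_Un_disjoint distinct_card)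
  qed
  then have "profile M (set xs \<union> B) (cycle_of_list xs \<circ> \<sigma>) =
      (\<lambda>l. profile M B \<sigma> l + (if l = length xs \<and> length xs \<le> M then length xs else 0))"
    using assms(2) by (auto simp: profile_def fun_eq_iff Suc_le_eq)
  then show ?thesis
    by (simp add: remove_cycle_def)
qed

section \<open>Counting permutations by their short cycles\<close>

definition profile_perms :: "nat \<Rightarrow> 'a set \<Rightarrow> (nat \<Rightarrow> nat) set \<Rightarrow> ('a \<Rightarrow> 'a) set" where
  "profile_perms M A G = {\<pi>. \<pi> permutes A \<and> profile M A \<pi> \<in> G}"

lemma finite_profile_perms: "finite A \<Longrightarrow> finite (profile_perms M A G)"
  by (rule finite_subset[OF _ finite_permutations[of A]]) (auto simp: profile_perms_def)

text \<open>Reading the cycle through x from x on gives a unique list \<open>x # ys\<close>; the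
  rest is any permutation of the remaining points with the adjusted profile condition.\<close>

lemma bij_betw_cycle_through:
  assumes A: "finite A" "x \<in> A"
  shows "bij_betw (\<lambda>(ys, \<sigma>). cycle_of_list (x # ys) \<circ> \<sigma>)
    (SIGMA ys:{ys. distinct ys \<and> set ys \<subseteq> A - {x}}.
       profile_perms M (A - set (x # ys)) (remove_cycle M (Suc (length ys)) G))
    (profile_perms M A G)"
    (is "bij_betw ?F (Sigma ?Y ?S) ?P")
proof (rule bij_betw_imageI)
  have cond: "distinct (x # ys)" "set (x # ys) \<union> (A - set (x # ys)) = A"
    "set (x # ys) \<inter> (A - set (x # ys)) = {}" if "ys \<in> ?Y" for ys
    using that A by auto
  have supp: "support (?F (ys, \<sigma>)) x = x # ys" if "ys \<in> ?Y" "\<sigma> \<in> ?S ys" for ys \<sigma>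
    using support_cycle_comp[OF cond(1,3) _ refl, of ys \<sigma>] that by (simp add: profile_perms_def)
  show "inj_on ?F (Sigma ?Y ?S)"
  proof (rule inj_onI, clarify)
    fix ys \<sigma> zs \<tau>
    assume *: "distinct ys" "set ys \<subseteq> A - {x}" "\<sigma> \<in> ?S ys" "distinct zs" "set zs \<subseteq> A - {x}" "\<tau> \<in> ?S zs"
      "cycle_of_list (x # ys) \<circ> \<sigma> = cycle_of_list (x # zs) \<circ> \<tau>"
    then have "x # ys = x # zs"
      using supp[of ys \<sigma>] supp[of zs \<tau>] by simp
    moreover from this have "\<sigma> = \<tau>"
      using *(7) permutes_inj[OF cycle_permutes[of "x # ys"]] by (simp add: fun_eq_iff inj_eq)
    ultimately show "ys = zs \<and> \<sigma> = \<tau>"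
      by simp
  qed
  show "?F ` Sigma ?Y ?S = ?P"
  proof (intro equalityI subsetI)
    fix \<pi> assume "\<pi> \<in> ?F ` Sigma ?Y ?S"
    then obtain ys \<sigma> where *: "ys \<in> ?Y" "\<sigma> \<in> ?S ys" "\<pi> = cycle_of_list (x # ys) \<circ> \<sigma>"
      by auto
    then have \<sigma>: "\<sigma> permutes A - set (x # ys)"
      by (simp add: profile_perms_def)
    show "\<pi> \<in> ?P"
      using cycle_comp_permutes[OF cond(1,3)[OF *(1)] \<sigma>]
        profile_cycle_comp[OF cond(1)[OF *(1)] _ cond(3)[OF *(1)] \<sigma>, of M G] *(2,3) A(1)
      unfolding cond(2)[OF *(1)] by (simp add: profile_perms_def)
  next
    fix \<pi> assume \<pi>: "\<pi> \<in> ?P"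
    then have perm: "\<pi> permutes A" by (simp add: profile_perms_def)
    have pm: "permutation \<pi>" using permutation_of_permutes[OF A(1) perm] .
    define ys where "ys = tl (support \<pi> x)"
    have "support \<pi> x \<noteq> []" "hd (support \<pi> x) = x"
      using least_power_of_permutation(2)[OF pm, of x] by (auto simp: hd_map)
    then have xys: "support \<pi> x = x # ys"
      unfolding ys_def by (metis list.collapse)
    have "distinct (x # ys)"
      using cycle_of_permutation[OF pm, of x] unfolding xys .
    moreover have "set (x # ys) \<subseteq> A"
      unfolding xys[symmetric] using A(2) funpow_in[OF perm] by auto
    ultimately have ys: "ys \<in> ?Y"
      by auto
    define \<sigma> where "\<sigma> = (\<lambda>y. if y \<in> A - set (x # ys) then \<pi> y else y)"
    have \<sigma>: "\<sigma> permutes A - set (x # ys)"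
      using semidecomposition[OF perm A(1), of x] unfolding xys \<sigma>_def .
    have "\<pi> = cycle_of_list (x # ys) \<circ> \<sigma>"
    proof
      fix a
      show "\<pi> a = (cycle_of_list (x # ys) \<circ> \<sigma>) a"
      proof (cases "a \<in> set (x # ys)")
        case True
        then show ?thesis
          using cycle_restrict[OF pm, of a x] unfolding xys by (auto simp: \<sigma>_def)
      next
        case False
        have "\<pi> a \<notin> set (x # ys)" if "a \<in> A"
        proof -
          have "\<sigma> a \<in> A - set (x # ys)"
            using that False permutes_in_image[OF \<sigma>, of a] by blast
          then show ?thesis
            using that False unfolding \<sigma>_def by auto
        qed
        then show ?thesis
          using False permutes_not_in[OF perm, of a] id_outside_supp[of _ "x # ys"] by (auto simp: \<sigma>_def)
      qed
    qed
    moreover have "\<sigma> \<in> ?S ys"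
      using profile_cycle_comp[OF cond(1)[OF ys] _ cond(3)[OF ys] \<sigma>, of M G] \<pi> \<sigma> A(1) calculation
      unfolding cond(2)[OF ys] by (simp add: profile_perms_def)
    ultimately show "\<pi> \<in> ?F ` Sigma ?Y ?S"
      using ys by (intro image_eqI[of _ _ "(ys, \<sigma>)"]) auto
  qed
qed

text \<open>The proportion of permutations of n points whose profile lies in G, by
  \<open>card_profile_perms\<close>. Here j is the number of points outside the cycle through a
  fixed point; all lengths Suc n - j of this cycle are equally likely.\<close>

fun freq :: "nat \<Rightarrow> nat \<Rightarrow> (nat \<Rightarrow> nat) set \<Rightarrow> real" where
  "freq M 0 G = of_bool ((\<lambda>_. 0) \<in> G)"
| "freq M (Suc n) G = (\<Sum>j\<le>n. freq M j (remove_cycle M (Suc n - j) G)) / real (Suc n)"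

declare freq.simps [simp del]

text \<open>There are n! / (n - j)! lists of length j that complete the cycle through x, and the
  other n - j points contribute (n - j)! times a proportion. The product has the factor n! for every
  j, so all cycle lengths weigh the same.\<close>

lemma card_profile_perms:
  "finite A \<Longrightarrow> real (card (profile_perms M A G)) = fact (card A) * freq M (card A) G"
proof (induction "card A" arbitrary: A G rule: less_induct)
  case less
  show ?case
  proof (cases "card A")
    case 0
    then have "A = {}" using less.prems by simp
    then have "profile M A id = (\<lambda>_. 0)"
      by (simp add: profile_def with_period_def fun_eq_iff)
    then have "profile_perms M A G = (if (\<lambda>_. 0) \<in> G then {id} else {})"
      using \<open>A = {}\<close> by (auto simp: profile_perms_def)
    then show ?thesis
      using 0 by (simp add: freq.simps)
  next
    case (Suc n)
    then obtain x where x: "x \<in> A"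
      by fastforce
    let ?Y = "{ys. distinct ys \<and> set ys \<subseteq> A - {x}}"
    have cardAx: "card (A - {x}) = n"
      using Suc x less.prems by simp
    have finY: "finite ?Y"
      by (rule finite_subset[OF _ finite_subset_distinct[of "A - {x}"]]) (use less.prems in auto)
    have len: "length ys \<le> n" if "ys \<in> ?Y" for ys
      using that cardAx less.prems card_mono[of "A - {x}" "set ys"] distinct_card[of ys] by simp
    have rest: "card (A - set (x # ys)) = n - length ys" if "ys \<in> ?Y" for ys
    proof -
      have "card (A - set (x # ys)) = card A - card (set (x # ys))"
        using that x by (intro card_Diff_subset) auto
      also have "card (set (x # ys)) = Suc (length ys)"
        using that by (intro distinct_card[of "x # ys", simplified length_Cons]) auto
      finally show ?thesis
        using Suc by simp
    qed
    have "real (card (profile_perms M A G)) =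
        real (card (SIGMA ys:?Y. profile_perms M (A - set (x # ys)) (remove_cycle M (Suc (length ys)) G)))"
      using bij_betw_same_card[OF bij_betw_cycle_through[OF less.prems x]] by metis
    also have "\<dots> = (\<Sum>ys\<in>?Y. real (card (profile_perms M (A - set (x # ys)) (remove_cycle M (Suc (length ys)) G))))"
      using finY less.prems by (subst card_SigmaI) (auto intro!: finite_profile_perms)
    also have "\<dots> = (\<Sum>ys\<in>?Y. fact (n - length ys) * freq M (n - length ys) (remove_cycle M (Suc (length ys)) G))"
      by (intro sum.cong refl) (use less.hyps rest Suc less.prems in auto)
    also have "\<dots> = (\<Sum>j\<le>n. \<Sum>ys | ys \<in> ?Y \<and> length ys = j.
        fact (n - length ys) * freq M (n - length ys) (remove_cycle M (Suc (length ys)) G))"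
      using len by (intro sum.group[symmetric] finY) auto
    also have "\<dots> = (\<Sum>j\<le>n. fact n * freq M (n - j) (remove_cycle M (Suc j) G))"
    proof (intro sum.cong refl)
      fix j assume "j \<in> {..n}"
      then have j: "j \<le> n" by simp
      have "card {ys. length ys = j \<and> distinct ys \<and> set ys \<subseteq> A - {x}} = \<Prod>{n - j + 1..n}"
        using card_lists_distinct_length_eq[of "A - {x}" j] cardAx j less.prems by simp
      then have "card {ys. ys \<in> ?Y \<and> length ys = j} = fact n div fact (n - j)"
        using fact_div_fact[of "n - j" n] j by (simp add: conj_ac)
      moreover have "real (fact n div fact (n - j)) * fact (n - j) = fact n"
        using fact_dvd[of "n - j" n] by (metis diff_le_self dvd_div_mult_self of_nat_fact of_nat_mult)
      ultimately show "(\<Sum>ys | ys \<in> ?Y \<and> length ys = j.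
          fact (n - length ys) * freq M (n - length ys) (remove_cycle M (Suc (length ys)) G)) =
          fact n * freq M (n - j) (remove_cycle M (Suc j) G)"
        by simp
    qed
    also have "\<dots> = fact n * (\<Sum>j\<le>n. freq M j (remove_cycle M (Suc n - j) G))"
      unfolding sum_distrib_left
      by (rule sum.reindex_bij_witness[of _ "\<lambda>j. n - j" "\<lambda>j. n - j"]) (auto simp: Suc_diff_le)
    also have "\<dots> = fact (card A) * freq M (card A) G"
      by (simp add: Suc freq.simps)
    finally show ?thesis .
  qed
qed

lemma freq_bounds: "0 \<le> freq M n G" "freq M n G \<le> 1"
proof -
  have *: "real (card (profile_perms M {1..n} G)) = fact n * freq M n G"
    using card_profile_perms[of "{1..n}" M G] by simp
  have "card (profile_perms M {1..n} G) \<le> card {\<pi>. \<pi> permutes {1..n}}"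
    by (intro card_mono finite_permutations) (auto simp: profile_perms_def)
  also have "\<dots> = fact n"
    by (simp add: card_permutations[of _ n])
  finally have "real (card (profile_perms M {1..n} G)) \<le> fact n"
    by (metis of_nat_fact of_nat_le_iff)
  then show "0 \<le> freq M n G" "freq M n G \<le> 1"
    using * by (simp_all add: field_simps) (metis fact_gt_zero mult_le_cancel_left_pos mult.right_neutral
      of_nat_0_le_iff zero_le_mult_iff not_less)+
qed

text \<open>A cycle longer than M does not affect the profile, so only M terms of the recurrence
  involve a modified set.\<close>

lemma freq_rec:
  assumes "M \<le> n" "0 < n"
  shows "real n * freq M n G = (\<Sum>k=1..M. freq M (n - k) (remove_cycle M k G)) + (\<Sum>j<n - M. freq M j G)"
proof -
  have "{..<n} = {n - M..<n} \<union> {..<n - M}" "{n - M..<n} \<inter> {..<n - M} = {}"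
    by auto
  then have "(\<Sum>j<n. freq M j (remove_cycle M (n - j) G)) =
      (\<Sum>j\<in>{n - M..<n}. freq M j (remove_cycle M (n - j) G)) + (\<Sum>j<n - M. freq M j (remove_cycle M (n - j) G))"
    by (simp add: sum.union_disjoint)
  also have "(\<Sum>j<n - M. freq M j (remove_cycle M (n - j) G)) = (\<Sum>j<n - M. freq M j G)"
    by (intro sum.cong refl) (simp add: remove_cycle_large)
  also have "(\<Sum>j\<in>{n - M..<n}. freq M j (remove_cycle M (n - j) G)) = (\<Sum>k=1..M. freq M (n - k) (remove_cycle M k G))"
    using assms by (intro sum.reindex_bij_witness[of _ "\<lambda>k. n - k" "\<lambda>j. n - j"]) auto
  moreover have "real n * freq M n G = (\<Sum>j<n. freq M j (remove_cycle M (n - j) G))"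
    using assms(2) by (cases n) (simp_all add: freq.simps lessThan_Suc_atMost)
  ultimately show ?thesis
    by simp
qed

text \<open>Subtracting consecutive recurrences leaves one new long term,
  \<open>freq M (n - M) G\<close>. Its difference from \<open>freq M n G\<close> telescopes into M
  increments, so the right side consists of 2 * M increments at indices below n.\<close>

lemma freq_increment:
  assumes "M \<le> n" "0 < n"
  shows "real (Suc n) * (freq M (Suc n) G - freq M n G) =
    (\<Sum>k=1..M. (freq M (Suc (n - k)) (remove_cycle M k G) - freq M (n - k) (remove_cycle M k G)) -
                 (freq M (Suc (n - k)) G - freq M (n - k) G))"
proof -
  have telescope: "(\<Sum>k=1..m. freq M (Suc (n - k)) G - freq M (n - k) G) = freq M n G - freq M (n - m) G"
    if "m \<le> n" for m
    using that
  proof (induction m)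
    case (Suc m)
    then show ?case by (simp add: Suc_diff_Suc)
  qed simp
  have "real (Suc n) * freq M (Suc n) G - real n * freq M n G =
     (\<Sum>k=1..M. freq M (Suc n - k) (remove_cycle M k G)) - (\<Sum>k=1..M. freq M (n - k) (remove_cycle M k G)) + freq M (n - M) G"
    using freq_rec[OF assms] freq_rec[of M "Suc n" G] assms by (simp add: Suc_diff_le del: of_nat_Suc)
  also have "(\<Sum>k=1..M. freq M (Suc n - k) (remove_cycle M k G)) = (\<Sum>k=1..M. freq M (Suc (n - k)) (remove_cycle M k G))"
    using assms by (intro sum.cong refl) (simp add: Suc_diff_le)
  finally show ?thesis
    using telescope[OF assms(1)] by (simp add: sum_subtractf sum.distrib algebra_simps)
qed

text \<open>For n \<ge> K the 2 * M earlier increments, each at most 2 ^ M times the claimed bound,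
  are absorbed by the factor n + 1; below K the bound exceeds 1 and is trivial. G varies in the
  induction because increments for \<open>remove_cycle M k G\<close> occur.\<close>

lemma freq_increment_bound:
  fixes M :: nat
  defines "K \<equiv> M * 2 ^ (M + 1) + M + 1"
  shows "\<bar>freq M (Suc n) G - freq M n G\<bar> \<le> 2 ^ K / 2 ^ n"
proof (induction n arbitrary: G rule: less_induct)
  case (less n)
  show ?case
  proof (cases "n < K")
    case True
    have "\<bar>freq M (Suc n) G - freq M n G\<bar> \<le> 1"
      using freq_bounds[of M n G] freq_bounds[of M "Suc n" G] by linarith
    also have "\<dots> \<le> 2 ^ K / 2 ^ n"
      using True by (simp add: field_simps)
    finally show ?thesis .
  next
    case False
    then have n: "M \<le> n" "0 < n" "M * 2 ^ (M + 1) \<le> n"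
      by (auto simp: K_def)
    have step: "\<bar>freq M (Suc (n - k)) H - freq M (n - k) H\<bar> \<le> 2 ^ M * (2 ^ K / 2 ^ n)"
      if "k \<in> {1..M}" for k H
    proof -
      have "\<bar>freq M (Suc (n - k)) H - freq M (n - k) H\<bar> \<le> 2 ^ K / 2 ^ (n - k)"
        using that n by (intro less.IH) auto
      also have "\<dots> = 2 ^ k * (2 ^ K / 2 ^ n)"
        using that n by (simp add: power_diff)
      also have "\<dots> \<le> 2 ^ M * (2 ^ K / 2 ^ n)"
        using that by (intro mult_right_mono power_increasing) auto
      finally show ?thesis .
    qed
    have "real (Suc n) * \<bar>freq M (Suc n) G - freq M n G\<bar> = \<bar>real (Suc n) * (freq M (Suc n) G - freq M n G)\<bar>"
      by (simp add: abs_mult)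
    also have "\<dots> \<le> (\<Sum>k=1..M. 2 * (2 ^ M * (2 ^ K / 2 ^ n)))"
      unfolding freq_increment[OF n(1,2)]
    proof (rule order.trans[OF sum_abs sum_mono])
      fix k assume "k \<in> {1..M}"
      then show "\<bar>(freq M (Suc (n - k)) (remove_cycle M k G) - freq M (n - k) (remove_cycle M k G)) -
          (freq M (Suc (n - k)) G - freq M (n - k) G)\<bar> \<le> 2 * (2 ^ M * (2 ^ K / 2 ^ n))"
        using step[of k G] step[of k "remove_cycle M k G"] by linarith
    qed
    also have "\<dots> = real (M * 2 ^ (M + 1)) * (2 ^ K / 2 ^ n)"
      by simp
    also have "\<dots> \<le> real (Suc n) * (2 ^ K / 2 ^ n)"
      using n(3) by (intro mult_right_mono) (auto simp del: of_nat_mult)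
    finally show ?thesis
      by (simp only: mult_le_cancel_left_pos of_nat_0_less_iff zero_less_Suc)
  qed
qed

lemma freq_convergent: "convergent (\<lambda>n. freq M n G)"
proof -
  define K where "K = M * 2 ^ (M + 1) + M + 1"
  have "summable (\<lambda>n. 2 ^ K * (1 / 2 :: real) ^ n)"
    by (intro summable_mult summable_geometric) simp
  then have "summable (\<lambda>n. freq M (Suc n) G - freq M n G)"
    by (rule summable_comparison_test') (use freq_increment_bound[of M] in \<open>simp add: K_def power_divide\<close>)
  then have "convergent (\<lambda>n. \<Sum>k<n. freq M (Suc k) G - freq M k G)"
    by (simp add: summable_iff_convergent)
  then have "convergent (\<lambda>n. freq M n G - freq M 0 G)"
    unfolding sum_lessThan_telescope[of "\<lambda>n. freq M n G"] .
  then show ?thesis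
    by (simp add: convergent_diff_const_right_iff)
qed

lemma sum_profile:
  assumes "finite A" "f permutes A"
  shows "(\<Sum>l=1..M. profile M A f l) = card {a \<in> A. least_power f a \<le> M}"
proof -
  have "{a \<in> A. least_power f a \<le> M} = (\<Union>l\<in>{1..M}. with_period A f l)"
    using least_power_pos[OF assms] by (auto simp: with_period_def Suc_le_eq)
  also have "card \<dots> = (\<Sum>l=1..M. card (with_period A f l))"
    using assms(1) by (intro card_UN_disjoint) (auto simp: with_period_def)
  finally show ?thesis
    by (simp add: profile_def)
qed

text \<open>The event in question says that no cycle is longer than \<open>M\<close>.\<close>

lemma freq_all_short:
  assumes "M \<le> n" "0 < n"
  shows "freq M n {h. (\<Sum>l=1..M. h l) = n} \<le> M / n"
proof -
  let ?H = "{h. (\<Sum>l=1..M. h l) = n}"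
  \<comment> \<open>Fewer than n points cannot supply n points on short cycles. So all terms for
    long cycles vanish and M terms remain, each at most 1.\<close>
  have "freq M j ?H = 0" if "j < n" for j
  proof -
    have "profile_perms M {1..j} ?H = {}"
    proof (rule ccontr)
      assume "profile_perms M {1..j} ?H \<noteq> {}"
      then obtain \<pi> where "\<pi> permutes {1..j}" "(\<Sum>l=1..M. profile M {1..j} \<pi> l) = n"
        by (auto simp: profile_perms_def)
      then have "n = card {a \<in> {1..j}. least_power \<pi> a \<le> M}"
        using sum_profile[of "{1..j}" \<pi> M] by simp
      also have "\<dots> \<le> card {1..j}"
        by (intro card_mono) auto
      finally show False
        using that by simp
    qed
    then show ?thesis
      using card_profile_perms[of "{1..j}" M ?H] by simp
  qed
  then have "real n * freq M n ?H = (\<Sum>k=1..M. freq M (n - k) (remove_cycle M k ?H))"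
    using freq_rec[OF assms, of ?H] by simp
  also have "\<dots> \<le> (\<Sum>k=1..M. 1)"
    by (intro sum_mono freq_bounds)
  finally show ?thesis
    using assms(2) by (simp add: field_simps)
qed

section \<open>The uniform distribution: convergence without a zero-one law\<close>

lemma prob_mallows:
  assumes "q > 0"
  shows "measure_pmf.prob (mallows n q) S =
    (\<Sum>\<pi> | \<pi> permutes {1..n} \<and> \<pi> \<in> S. q ^ inversions n \<pi>) / (\<Sum>\<sigma> | \<sigma> permutes {1..n}. q ^ inversions n \<sigma>)"
proof -
  let ?T = "{\<pi>. \<pi> permutes {1..n} \<and> \<pi> \<in> S}"
  have fin: "finite ?T"
    by (rule finite_subset[OF _ finite_permutations[of "{1..n}"]]) auto
  have "measure_pmf.prob (mallows n q) S = measure_pmf.prob (mallows n q) ?T"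
    by (rule measure_pmf.finite_measure_eq_AE) (auto simp: AE_measure_pmf_iff set_pmf_eq pmf_mallows[OF assms])
  also have "\<dots> = (\<Sum>\<pi>\<in>?T. pmf (mallows n q) \<pi>)"
    by (rule measure_measure_pmf_finite[OF fin])
  also have "\<dots> = (\<Sum>\<pi>\<in>?T. q ^ inversions n \<pi> / (\<Sum>\<sigma> | \<sigma> permutes {1..n}. q ^ inversions n \<sigma>))"
    by (intro sum.cong refl) (simp add: pmf_mallows[OF assms])
  finally show ?thesis
    by (simp add: sum_divide_distrib)
qed

lemma prob_uniform:
  "measure_pmf.prob (mallows n 1) S = card {\<pi>. \<pi> permutes {1..n} \<and> \<pi> \<in> S} / fact n"
  by (simp add: prob_mallows card_permutations[of _ n])

lemma prob_uniform_profile: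
  "measure_pmf.prob (mallows n 1) {\<pi>. profile M {1..n} \<pi> \<in> G} = freq M n G"
  using card_profile_perms[of "{1..n}" M G] by (simp add: prob_uniform profile_perms_def)

lemma uniform_convergence_law: "convergence_law (\<lambda>n. mallows n 1)"
  unfolding convergence_law_def
proof (intro allI impI)
  fix \<phi> assume "sentence \<phi>"
  then obtain c where c: "\<And>n \<pi> m \<sigma>. \<lbrakk>\<pi> permutes {1..n}; \<sigma> permutes {1..m}; matching c {1..n} \<pi> {1..m} \<sigma>\<rbrakk>
    \<Longrightarrow> models n \<pi> \<phi> \<longleftrightarrow> models m \<sigma> \<phi>"
    by (rule models_matching) blast
  define long where "long n \<pi> \<longleftrightarrow> (\<exists>a\<in>{1..n}. c < least_power \<pi> a)" for n :: nat and \<pi> :: "nat \<Rightarrow> nat"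
  \<comment> \<open>All sizes m are collected, so that G does not depend on n. Only permutations
    with a cycle longer than c enter, as \<open>matching\<close> requires one.\<close>
  define G where "G = {profile c {1..m} \<sigma> | m \<sigma>. \<sigma> permutes {1..m} \<and> long m \<sigma> \<and> models m \<sigma> \<phi>}"
  let ?P = "\<lambda>n S. measure_pmf.prob (mallows n 1) S"
  define H where "H n = {h. (\<Sum>l=1..c. h l) = n}" for n :: nat
  have G: "models n \<pi> \<phi> \<longleftrightarrow> profile c {1..n} \<pi> \<in> G" if "\<pi> permutes {1..n}" "long n \<pi>" for n \<pi>
  proof
    assume "models n \<pi> \<phi>"
    then show "profile c {1..n} \<pi> \<in> G"
      using that by (auto simp: G_def)
  next
    assume "profile c {1..n} \<pi> \<in> G"
    then obtain m \<sigma> where *: "profile c {1..n} \<pi> = profile c {1..m} \<sigma>" "\<sigma> permutes {1..m}"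
        "long m \<sigma>" "models m \<sigma> \<phi>"
      by (auto simp: G_def)
    have "card (with_period {1..n} \<pi> l) = card (with_period {1..m} \<sigma> l)" if "l \<in> {1..c}" for l
      using fun_cong[OF *(1), of l] that by (simp add: profile_def)
    then have "matching c {1..n} \<pi> {1..m} \<sigma>"
      using that(2) *(3) by (simp add: matching_def long_def)
    then show "models n \<pi> \<phi>"
      using c that(1) *(2,4) by blast
  qed
  have H: "profile c {1..n} \<pi> \<in> H n" if "\<pi> permutes {1..n}" "\<not> long n \<pi>" for n \<pi>
  proof -
    have "{a \<in> {1..n}. least_power \<pi> a \<le> c} = {1..n}"
      using that(2) by (auto simp: long_def not_less)
    then show ?thesis
      using sum_profile[OF _ that(1), of c] by (simp add: H_def)
  qed
  have perm: "AE \<pi> in mallows n 1. \<pi> permutes {1..n}" for n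
    by (auto simp: AE_measure_pmf_iff set_pmf_eq pmf_mallows split: if_splits)
  \<comment> \<open>The two events differ only where no cycle is longer than c.\<close>
  have bound: "norm (?P n {\<pi>. models n \<pi> \<phi>} - freq c n G) \<le> c / n" if n: "n \<ge> Suc c" for n
  proof -
    have "?P n {\<pi>. models n \<pi> \<phi>} \<le> ?P n ({\<pi>. profile c {1..n} \<pi> \<in> G} \<union> {\<pi>. profile c {1..n} \<pi> \<in> H n})"
      by (rule measure_pmf.finite_measure_mono_AE) (use perm[of n] G H in \<open>auto elim!: eventually_mono\<close>)
    also have "\<dots> \<le> freq c n G + freq c n (H n)"
      by (rule order.trans[OF measure_subadditive]) (simp_all add: prob_uniform_profile[unfolded One_nat_def])
    finally have 1: "?P n {\<pi>. models n \<pi> \<phi>} \<le> freq c n G + freq c n (H n)" .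
    have "?P n {\<pi>. profile c {1..n} \<pi> \<in> G} \<le> ?P n ({\<pi>. models n \<pi> \<phi>} \<union> {\<pi>. profile c {1..n} \<pi> \<in> H n})"
      by (rule measure_pmf.finite_measure_mono_AE) (use perm[of n] G H in \<open>auto elim!: eventually_mono\<close>)
    also have "\<dots> \<le> ?P n {\<pi>. models n \<pi> \<phi>} + freq c n (H n)"
      by (rule order.trans[OF measure_subadditive]) (simp_all add: prob_uniform_profile[unfolded One_nat_def])
    finally have 2: "freq c n G \<le> ?P n {\<pi>. models n \<pi> \<phi>} + freq c n (H n)"
      unfolding prob_uniform_profile .
    have "freq c n (H n) \<le> c / n"
      unfolding H_def by (rule freq_all_short) (use n in auto)
    then show ?thesis
      using 1 2 by (simp add: abs_le_iff)
  qed
  have "(\<lambda>n. ?P n {\<pi>. models n \<pi> \<phi>} - freq c n G) \<longlonglongrightarrow> 0"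
    by (rule Lim_null_comparison[OF _ lim_const_over_n[of "real c"]])
      (rule eventually_mono[OF eventually_ge_at_top bound])
  then have "convergent (\<lambda>n. (?P n {\<pi>. models n \<pi> \<phi>} - freq c n G) + freq c n G)"
    by (intro convergent_add freq_convergent) (auto simp: convergent_def)
  then show "convergent (\<lambda>n. ?P n {\<pi>. models n \<pi> \<phi>})"
    by simp
qed

text \<open>For the probability p n of having no fixed point, n * p n is the sum of all p j with j <
  n - 1, where p 0 = 1 and p 1 = 0. For n = m + 3 this is 1 plus m values covered by the induction
  hypothesis, and 1 + m / 3 = n / 3, while 1 + m / 2 \<le> n / 2.\<close>

lemma derangement_freq_bounds:
  "n \<ge> 2 \<Longrightarrow> 1 / 3 \<le> freq 1 n {h. h 1 = 0} \<and> freq 1 n {h. h 1 = 0} \<le> 1 / 2"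
proof (induction n rule: less_induct)
  case (less n)
  let ?p = "\<lambda>n. freq 1 n {h. h 1 = 0}"
  have sh: "remove_cycle 1 1 {h. h 1 = 0} = {}"
    by (auto simp: remove_cycle_def)
  have empty: "freq 1 j {} = 0" for j
    using card_profile_perms[of "{1..j}" 1 "{}"] by (simp add: profile_perms_def)
  have rec: "real m * ?p m = (\<Sum>j<m - 1. ?p j)" if "m \<ge> 1" for m
    using freq_rec[of 1 m "{h. h 1 = 0}"] that by (simp add: sh[simplified] empty[simplified])
  have p0: "?p 0 = 1" "?p 1 = 0"
    using rec[of 1] by (simp_all add: freq.simps)
  show ?case
  proof (cases "n = 2")
    case True
    then show ?thesis
      using rec[of 2] p0 by simp
  next
    case False
    then obtain m where m: "n = m + 3"
      using less.prems by (metis add.commute le_Suc_ex le_neq_implies_less numeral_2_eq_2 numeral_3_eq_3 Suc_leI)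
    have *: "real n * ?p n = 1 + (\<Sum>j<m. ?p (j + 2))"
      using rec[of n] less.prems p0 m
      by (simp add: lessThan_Suc_atMost[symmetric] sum.lessThan_Suc_shift numeral_2_eq_2 del: sum.lessThan_Suc)
    have IH: "1 / 3 \<le> ?p (j + 2)" "?p (j + 2) \<le> 1 / 2" if "j < m" for j
      using less.IH[of "j + 2"] that m by auto
    have "(\<Sum>j<m. 1 / 3) \<le> (\<Sum>j<m. ?p (j + 2))" "(\<Sum>j<m. ?p (j + 2)) \<le> (\<Sum>j<m. 1 / 2)"
      by (intro sum_mono; use IH in auto)+
    then have "real n * (1 / 3) \<le> real n * ?p n" "real n * ?p n \<le> real n * (1 / 2)"
      unfolding * using m by simp_all
    then show ?thesis
      using m by (simp only: mult_le_cancel_left_pos of_nat_0_less_iff)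
  qed
qed

text \<open>By the derangement bounds, a fixed point exists with probability between 1 / 2 and 2 / 3
  from n = 2 on.\<close>

lemma uniform_not_zero_one_law: "\<not> zero_one_law (\<lambda>n. mallows n 1)"
proof
  define \<phi> where "\<phi> = Exists 0 (Rel 0 0)"
  let ?P = "\<lambda>n. measure_pmf.prob (mallows n 1) {\<pi>. models n \<pi> \<phi>}"
  have \<phi>: "sentence \<phi>"
    by (simp add: sentence_def \<phi>_def)
  have models: "models n \<pi> \<phi> \<longleftrightarrow> (\<exists>a\<in>{1..n}. \<pi> a = a)" for n \<pi>
    using models_iff_sat[OF \<phi>, of n \<pi> id] by (simp add: \<phi>_def)
  have fixed: "models n \<pi> \<phi> \<longleftrightarrow> \<not> profile 1 {1..n} \<pi> \<in> {h. h 1 = 0}" if "\<pi> permutes {1..n}" for n \<pi>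
  proof -
    have "least_power \<pi> a = 1 \<longleftrightarrow> \<pi> a = a" for a
      using funpow_eq_self_iff[OF _ that, of 1 a] by simp
    then have "with_period {1..n} \<pi> 1 = {a \<in> {1..n}. \<pi> a = a}"
      by (auto simp: with_period_def)
    then show ?thesis
      by (auto simp: models profile_def)
  qed
  have perm: "AE \<pi> in mallows n 1. \<pi> permutes {1..n}" for n
    by (auto simp: AE_measure_pmf_iff set_pmf_eq pmf_mallows split: if_splits)
  have P: "?P n = 1 - freq 1 n {h. h 1 = 0}" for n
  proof -
    have "?P n = measure_pmf.prob (mallows n 1) (- {\<pi>. profile 1 {1..n} \<pi> \<in> {h. h 1 = 0}})"
      by (rule measure_pmf.finite_measure_eq_AE) (use perm[of n] fixed in \<open>auto elim!: eventually_mono\<close>)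
    also have "\<dots> = 1 - freq 1 n {h. h 1 = 0}"
      unfolding prob_uniform_profile[of n 1 "{h. h 1 = 0}", symmetric]
      by (subst measure_pmf.prob_compl[symmetric]) (auto simp: Compl_eq_Diff_UNIV)
    finally show ?thesis .
  qed
  assume "zero_one_law (\<lambda>n. mallows n 1)"
  then have conv: "?P \<longlonglongrightarrow> lim ?P" and lim: "lim ?P \<in> {0, 1}"
    using \<phi> by (auto simp: zero_one_law_def convergence_law_def convergent_LIMSEQ_iff)
  have "1 / 2 \<le> lim ?P"
    by (rule LIMSEQ_le_const[OF conv]) (use derangement_freq_bounds in \<open>auto intro!: exI[of _ 2] simp: P\<close>)
  moreover have "lim ?P \<le> 2 / 3"
    by (rule LIMSEQ_le_const2[OF conv]) (use derangement_freq_bounds in \<open>auto intro!: exI[of _ 2] simp: P\<close>)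
  ultimately show False
    using lim by auto
qed

section \<open>Weights of permutations preserving blocks\<close>

definition inv_on :: "nat set \<Rightarrow> (nat \<Rightarrow> nat) \<Rightarrow> nat" where
  "inv_on A \<pi> = card {(i, j). i \<in> A \<and> j \<in> A \<and> i < j \<and> \<pi> i > \<pi> j}"

lemma inversions_eq_inv_on: "inversions n \<pi> = inv_on {0<..n} \<pi>"
  unfolding inversions_def inv_on_def by (rule arg_cong[where f = card]) auto

definition weight :: "real \<Rightarrow> nat set \<Rightarrow> (nat \<Rightarrow> nat) set \<Rightarrow> real" where
  "weight q A E = (\<Sum>\<pi> | \<pi> permutes A \<and> \<pi> \<in> E. q ^ inv_on A \<pi>)"

text \<open>E and F are tested on restrictions extended by the identity, so a direct sum can itself
  serve as the condition on a part. A permutation of the disjoint union that preserves A also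
  preserves B.\<close>

definition direct_sum ::
  "nat set \<Rightarrow> (nat \<Rightarrow> nat) set \<Rightarrow> nat set \<Rightarrow> (nat \<Rightarrow> nat) set \<Rightarrow> (nat \<Rightarrow> nat) set" where
  "direct_sum A E B F = {\<pi>. \<pi> ` A = A \<and> restrict_id \<pi> A \<in> E \<and> restrict_id \<pi> B \<in> F}"

lemma restrict_id_comp_disjoint:
  assumes "\<alpha> permutes A" "\<beta> permutes B" "A \<inter> B = {}"
  shows "restrict_id (\<alpha> \<circ> \<beta>) A = \<alpha>" "restrict_id (\<alpha> \<circ> \<beta>) B = \<beta>"
proof -
  have "\<alpha> (\<beta> x) = \<alpha> x" if "x \<in> A" for x
    using that assms(3) permutes_not_in[OF assms(2), of x] by (auto simp: disjoint_iff)
  then show "restrict_id (\<alpha> \<circ> \<beta>) A = \<alpha>"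
    using permutes_not_in[OF assms(1)] by (auto simp: restrict_id_def fun_eq_iff)
  have "\<alpha> (\<beta> x) = \<beta> x" if "x \<in> B" for x
    using that assms(3) permutes_in_image[OF assms(2), of x] permutes_not_in[OF assms(1), of "\<beta> x"]
    by (auto simp: disjoint_iff)
  then show "restrict_id (\<alpha> \<circ> \<beta>) B = \<beta>"
    using permutes_not_in[OF assms(2)] by (auto simp: restrict_id_def fun_eq_iff)
qed

lemma restrict_id_permutes:
  assumes "\<pi> permutes A" "B \<subseteq> A" "\<pi> ` B = B"
  shows "restrict_id \<pi> B permutes B"
  using assms by (intro permutes_restrict_id bij_betw_imageI inj_on_subset[OF permutes_inj_on[OF assms(1)]]) auto

lemma image_Diff_permutes:
  assumes "\<pi> permutes A" "\<pi> ` B = B" "\<pi> ` C = C"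
  shows "\<pi> ` (C - B) = C - B"
  using assms by (simp add: image_set_diff[OF permutes_inj[OF assms(1)]])

text \<open>Both parts are preserved and A lies below B, so no pair across the parts is
  inverted.\<close>

lemma inv_on_comp_disjoint:
  assumes "\<alpha> permutes A" "\<beta> permutes B" "finite A" "finite B" and less: "\<And>a b. a \<in> A \<Longrightarrow> b \<in> B \<Longrightarrow> a < b"
  shows "inv_on (A \<union> B) (\<alpha> \<circ> \<beta>) = inv_on A \<alpha> + inv_on B \<beta>"
proof -
  have disj: "A \<inter> B = {}"
    using less by fastforce
  have A: "(\<alpha> \<circ> \<beta>) x = \<alpha> x" "\<alpha> x \<in> A" if "x \<in> A" for x
    using that disj permutes_not_in[OF assms(2), of x] permutes_in_image[OF assms(1)]
    by (auto simp: disjoint_iff)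
  have B: "(\<alpha> \<circ> \<beta>) x = \<beta> x" "\<beta> x \<in> B" if "x \<in> B" for x
    using that disj permutes_not_in[OF assms(1), of "\<beta> x"] permutes_in_image[OF assms(2), of x]
    by (auto simp: disjoint_iff)
  let ?S = "\<lambda>C \<pi>. {(i, j). i \<in> C \<and> j \<in> C \<and> i < j \<and> \<pi> i > \<pi> j}"
  have fin: "finite (?S C \<pi>)" if "finite C" for C and \<pi> :: "nat \<Rightarrow> nat"
    by (rule finite_subset[of _ "C \<times> C"]) (use that in auto)
  have "?S (A \<union> B) (\<alpha> \<circ> \<beta>) = ?S A \<alpha> \<union> ?S B \<beta>"
  proof (intro set_eqI iffI)
    fix p assume "p \<in> ?S (A \<union> B) (\<alpha> \<circ> \<beta>)"
    then obtain i j where *: "p = (i, j)" "i \<in> A \<union> B" "j \<in> A \<union> B" "i < j" "(\<alpha> \<circ> \<beta>) j < (\<alpha> \<circ> \<beta>) i"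
      by auto
    show "p \<in> ?S A \<alpha> \<union> ?S B \<beta>"
    proof (cases "i \<in> A")
      case True
      then have "j \<in> A"
        using * A[of i] B[of j] less[of "\<alpha> i" "\<beta> j"] by fastforce
      then show ?thesis
        using True * A by simp
    next
      case False
      then have "j \<in> B" "i \<in> B"
        using * less[of j i] by auto
      then show ?thesis
        using * B by simp
    qed
  next
    fix p assume "p \<in> ?S A \<alpha> \<union> ?S B \<beta>"
    then show "p \<in> ?S (A \<union> B) (\<alpha> \<circ> \<beta>)"
      using A(1) B(1) by auto
  qed
  moreover have "?S A \<alpha> \<inter> ?S B \<beta> = {}"
    using disj by auto
  ultimately show ?thesis
    unfolding inv_on_def using fin[OF assms(3)] fin[OF assms(4)] by (simp add: card_Un_disjoint)
qed

text \<open>Composing the two restrictions is a bijection under which inversions add up, so the sum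
  over pairs is a product.\<close>

lemma weight_direct_sum:
  assumes fin: "finite A" "finite B" and less: "\<And>a b. a \<in> A \<Longrightarrow> b \<in> B \<Longrightarrow> a < b"
  shows "weight q (A \<union> B) (direct_sum A E B F) = weight q A E * weight q B F"
proof -
  have disj: "A \<inter> B = {}"
    using less by fastforce
  then have B_eq: "A \<union> B - A = B"
    by blast
  let ?P = "{\<alpha>. \<alpha> permutes A \<and> \<alpha> \<in> E}" and ?Q = "{\<beta>. \<beta> permutes B \<and> \<beta> \<in> F}"
  have "weight q A E * weight q B F = (\<Sum>(\<alpha>, \<beta>)\<in>?P \<times> ?Q. q ^ inv_on A \<alpha> * q ^ inv_on B \<beta>)"
    by (simp add: weight_def sum_product sum.cartesian_product)
  also have "\<dots> = (\<Sum>\<pi> | \<pi> permutes (A \<union> B) \<and> \<pi> \<in> direct_sum A E B F. q ^ inv_on (A \<union> B) \<pi>)"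
  proof (rule sum.reindex_bij_witness[of _ "\<lambda>\<pi>. (restrict_id \<pi> A, restrict_id \<pi> B)" "\<lambda>(\<alpha>, \<beta>). \<alpha> \<circ> \<beta>"], goal_cases)
    case (1 p)
    then obtain \<alpha> \<beta> where p: "p = (\<alpha>, \<beta>)" "\<alpha> permutes A" "\<beta> permutes B" by auto
    show ?case
      unfolding p(1) using restrict_id_comp_disjoint[OF p(2,3) disj] by simp
  next
    case (2 p)
    then obtain \<alpha> \<beta> where p: "p = (\<alpha>, \<beta>)" "\<alpha> permutes A" "\<beta> permutes B" "\<alpha> \<in> E" "\<beta> \<in> F" by auto
    have "\<alpha> permutes A \<union> B" "\<beta> permutes A \<union> B"
      using p(2,3) by (auto intro: permutes_subset)
    then have "\<alpha> \<circ> \<beta> permutes A \<union> B"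
      by (intro permutes_compose)
    moreover have "(\<alpha> \<circ> \<beta>) ` A = \<alpha> ` A"
      using disj permutes_not_in[OF p(3)] by (intro image_cong) (auto simp: disjoint_iff)
    ultimately show ?case
      using p restrict_id_comp_disjoint[OF p(2,3) disj] permutes_image[OF p(2)] by (simp add: direct_sum_def)
  next
    case (3 \<pi>)
    then have \<pi>: "\<pi> permutes A \<union> B" "\<pi> ` A = A"
      by (simp_all add: direct_sum_def)
    have "\<pi> ` B = B"
      using image_Diff_permutes[OF \<pi> permutes_image[OF \<pi>(1)]] unfolding B_eq .
    have "restrict_id \<pi> A \<circ> restrict_id \<pi> B = \<pi>"
    proof
      fix x
      have "\<pi> x \<notin> A" if "x \<in> B"
        using that disj \<open>\<pi> ` B = B\<close> by blast
      then show "(restrict_id \<pi> A \<circ> restrict_id \<pi> B) x = \<pi> x"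
        using disj permutes_not_in[OF \<pi>(1), of x] by (auto simp: restrict_id_def)
    qed
    then show ?case
      by simp
  next
    case (4 \<pi>)
    then have \<pi>: "\<pi> permutes A \<union> B" "\<pi> ` A = A"
      by (simp_all add: direct_sum_def)
    have "\<pi> ` B = B"
      using image_Diff_permutes[OF \<pi> permutes_image[OF \<pi>(1)]] unfolding B_eq .
    then show ?case
      using 4 restrict_id_permutes[OF \<pi>(1) _ \<pi>(2)] restrict_id_permutes[OF \<pi>(1) _ \<open>\<pi> ` B = B\<close>]
      by (simp add: direct_sum_def)
  next
    case (5 p)
    then obtain \<alpha> \<beta> where p: "p = (\<alpha>, \<beta>)" "\<alpha> permutes A" "\<beta> permutes B" by auto
    show ?case
      unfolding p(1) using inv_on_comp_disjoint[OF p(2,3) fin less] by (simp add: power_add)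
  qed
  finally show ?thesis
    by (simp add: weight_def)
qed

text \<open>Precomposing with this cycle moves the value at position m to position k and shifts the
  values from k on one place to the right. With the largest value at m, this inserts it at
  k.\<close>

definition rotation :: "nat \<Rightarrow> nat \<Rightarrow> nat \<Rightarrow> nat" where
  "rotation k m = (\<lambda>i. if i = k then m else if k < i \<and> i \<le> m then i - 1 else i)"

lemma rotation_permutes:
  assumes "a < k" "k \<le> m"
  shows "rotation k m permutes {a<..m}"
proof (rule bij_imp_permutes)
  show "bij_betw (rotation k m) {a<..m} {a<..m}"
    by (rule bij_betw_byWitness[where f' = "\<lambda>i. if i = m then k else if k \<le> i \<and> i < m then i + 1 else i"])
      (use assms in \<open>auto simp: rotation_def\<close>)
qed (use assms in \<open>auto simp: rotation_def\<close>)

text \<open>The value Suc b, inserted at position k, is inverted with each of the Suc b - k later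
  positions; the other values keep their order.\<close>

lemma inv_on_comp_rotation:
  assumes k: "a < k" "k \<le> Suc b" and \<sigma>: "\<sigma> permutes {a<..b}"
  shows "inv_on {a<..Suc b} (\<sigma> \<circ> rotation k (Suc b)) = inv_on {a<..b} \<sigma> + (Suc b - k)"
proof -
  let ?r = "rotation k (Suc b)"
  let ?S = "{(i, j). i \<in> {a<..Suc b} \<and> j \<in> {a<..Suc b} \<and> i < j \<and> (\<sigma> \<circ> ?r) i > (\<sigma> \<circ> ?r) j}"
  let ?T = "{(i, j). i \<in> {a<..b} \<and> j \<in> {a<..b} \<and> i < j \<and> \<sigma> i > \<sigma> j}"
  \<comment> \<open>The increasing right inverse of the rotation, which skips position k.\<close>
  let ?e = "\<lambda>i. if i < k then i else Suc i"
  have \<sigma>b: "\<sigma> (Suc b) = Suc b"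
    using permutes_not_in[OF \<sigma>, of "Suc b"] by simp
  have \<sigma>le: "\<sigma> i \<le> b" if "a < i" "i \<le> b" for i
    using permutes_in_image[OF \<sigma>, of i] that by simp
  have re: "?r (?e i) = i" if "i \<le> b" for i
    using that by (auto simp: rotation_def)
  have "?S = (\<lambda>(i, j). (?e i, ?e j)) ` ?T \<union> (\<lambda>j. (k, j)) ` {k<..Suc b}"
  proof (intro equalityI subsetI)
    fix p assume "p \<in> ?S"
    then obtain i j where p: "p = (i, j)" "a < i" "i < j" "j \<le> Suc b" "\<sigma> (?r i) > \<sigma> (?r j)"
      by auto
    have rle: "a < ?r x \<and> ?r x \<le> b \<and> ?e (?r x) = x" if "x \<noteq> k" "a < x" "x \<le> Suc b" for x
      using that k by (auto simp: rotation_def)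
    have rmono: "?r i < ?r j" if "i \<noteq> k" "j \<noteq> k"
      using that p by (auto simp: rotation_def)
    show "p \<in> (\<lambda>(i, j). (?e i, ?e j)) ` ?T \<union> (\<lambda>j. (k, j)) ` {k<..Suc b}"
    proof (cases "i = k")
      case True
      then show ?thesis
        using p by auto
    next
      case False
      have "j \<noteq> k"
      proof
        assume "j = k"
        then have "?r j = Suc b" by (simp add: rotation_def)
        moreover have "\<sigma> (?r i) \<le> b"
          using rle[OF False] p by (intro \<sigma>le) auto
        ultimately show False
          using p \<sigma>b by simp
      qed
      then have "(?r i, ?r j) \<in> ?T" "p = (?e (?r i), ?e (?r j))"
        using rle[OF False] rle[OF \<open>j \<noteq> k\<close>] rmono False p by auto
      then show ?thesis
        by (intro UnI1 image_eqI[of _ _ "(?r i, ?r j)"]) auto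
    qed
  next
    fix p assume "p \<in> (\<lambda>(i, j). (?e i, ?e j)) ` ?T \<union> (\<lambda>j. (k, j)) ` {k<..Suc b}"
    then show "p \<in> ?S"
    proof
      assume "p \<in> (\<lambda>(i, j). (?e i, ?e j)) ` ?T"
      then obtain i j where p: "p = (?e i, ?e j)" "a < i" "i < j" "j \<le> b" "\<sigma> i > \<sigma> j"
        by auto
      then have "\<sigma> (?r (?e i)) > \<sigma> (?r (?e j))"
        using re[of i] re[of j] by simp
      then show ?thesis
        using p by auto
    next
      assume "p \<in> (\<lambda>j. (k, j)) ` {k<..Suc b}"
      then obtain j where j: "p = (k, j)" "k < j" "j \<le> Suc b" by auto
      then have "?r k = Suc b" "?r j = j - 1"
        by (auto simp: rotation_def)
      moreover have "\<sigma> (j - 1) \<le> b"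
        using j k by (intro \<sigma>le) auto
      ultimately show ?thesis
        using j k \<sigma>b by auto
    qed
  qed
  moreover have "?e i \<noteq> k" for i
    by simp
  then have "(\<lambda>(i, j). (?e i, ?e j)) ` ?T \<inter> (\<lambda>j. (k, j)) ` {k<..Suc b} = {}"
    by (auto simp del: if_split_asm split del: if_split)
  moreover have "finite ?T"
    by (rule finite_subset[of _ "{a<..b} \<times> {a<..b}"]) auto
  moreover have "inj_on (\<lambda>(i, j). (?e i, ?e j)) ?T"
    by (rule inj_onI) (auto split: if_splits)
  ultimately show ?thesis
    unfolding inv_on_def by (simp add: card_Un_disjoint card_image inj_on_def)
qed

text \<open>Each permutation of the longer interval arises once by inserting the largest value;
  summing over its position gives the geometric factor.\<close>

lemma weight_Suc:
  assumes "a \<le> b"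
  shows "weight q {a<..Suc b} UNIV = weight q {a<..b} UNIV * (\<Sum>i\<le>b - a. q ^ i)"
proof -
  let ?P = "{\<sigma>. \<sigma> permutes {a<..b}}"
  have "(\<Sum>i\<le>b - a. q ^ i) = (\<Sum>k\<in>{a<..Suc b}. q ^ (Suc b - k))"
    by (rule sum.reindex_bij_witness[of _ "\<lambda>k. Suc b - k" "\<lambda>i. Suc b - i"]) (use assms in auto)
  then have "weight q {a<..b} UNIV * (\<Sum>i\<le>b - a. q ^ i) =
      (\<Sum>(\<sigma>, k)\<in>?P \<times> {a<..Suc b}. q ^ inv_on {a<..b} \<sigma> * q ^ (Suc b - k))"
    by (simp add: weight_def sum_product sum.cartesian_product)
  also have "\<dots> = (\<Sum>\<pi> | \<pi> permutes {a<..Suc b}. q ^ inv_on {a<..Suc b} \<pi>)"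
  proof (rule sum.reindex_bij_witness[of _
        "\<lambda>\<pi>. (\<pi> \<circ> inv (rotation (inv \<pi> (Suc b)) (Suc b)), inv \<pi> (Suc b))"
        "\<lambda>(\<sigma>, k). \<sigma> \<circ> rotation k (Suc b)"], goal_cases)
    case (1 p)
    then obtain \<sigma> k where p: "p = (\<sigma>, k)" "\<sigma> permutes {a<..b}" "a < k" "k \<le> Suc b" by auto
    have perm: "\<sigma> \<circ> rotation k (Suc b) permutes {a<..Suc b}"
      using p by (intro permutes_compose rotation_permutes permutes_subset[OF p(2)]) auto
    have "(\<sigma> \<circ> rotation k (Suc b)) k = Suc b"
      using permutes_not_in[OF p(2), of "Suc b"] by (simp add: rotation_def)
    then have "inv (\<sigma> \<circ> rotation k (Suc b)) (Suc b) = k"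
      using permutes_inv_eq[OF perm] by blast
    then show ?case
      using p permutes_inv_o(1)[OF rotation_permutes[OF p(3,4)]] by (simp add: comp_assoc)
  next
    case (2 p)
    then obtain \<sigma> k where p: "p = (\<sigma>, k)" "\<sigma> permutes {a<..b}" "a < k" "k \<le> Suc b" by auto
    then show ?case
      by (auto intro!: permutes_compose rotation_permutes permutes_subset[OF p(2)])
  next
    case (3 \<pi>)
    then have \<pi>: "\<pi> permutes {a<..Suc b}" by simp
    then have "inv \<pi> (Suc b) \<in> {a<..Suc b}"
      using permutes_in_image[OF permutes_inv[OF \<pi>], of "Suc b"] assms by simp
    then show ?case
      using permutes_inv_o(2)[OF rotation_permutes[of a "inv \<pi> (Suc b)" "Suc b"]] by (simp add: comp_assoc)
  next
    case (4 \<pi>)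
    then have \<pi>: "\<pi> permutes {a<..Suc b}" by simp
    then have k: "inv \<pi> (Suc b) \<in> {a<..Suc b}"
      using permutes_in_image[OF permutes_inv[OF \<pi>], of "Suc b"] assms by simp
    then have rot: "rotation (inv \<pi> (Suc b)) (Suc b) permutes {a<..Suc b}"
      by (intro rotation_permutes) auto
    let ?\<sigma> = "\<pi> \<circ> inv (rotation (inv \<pi> (Suc b)) (Suc b))"
    have perm: "?\<sigma> permutes {a<..Suc b}"
      by (intro permutes_compose permutes_inv rot \<pi>)
    have "inv (rotation (inv \<pi> (Suc b)) (Suc b)) (Suc b) = inv \<pi> (Suc b)"
      unfolding permutes_inv_eq[OF rot] by (simp add: rotation_def)
    then have "?\<sigma> (Suc b) = Suc b"
      by (simp add: permutes_inverses(1)[OF \<pi>])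
    have "?\<sigma> permutes {a<..b}"
    proof (rule permutes_superset[OF perm])
      fix x assume "x \<in> {a<..Suc b} - {a<..b}"
      then have "x = Suc b" by auto
      then show "?\<sigma> x = x"
        using \<open>?\<sigma> (Suc b) = Suc b\<close> by (simp only:)
    qed
    with k show ?case by simp
  next
    case (5 p)
    then obtain \<sigma> k where p: "p = (\<sigma>, k)" "\<sigma> permutes {a<..b}" "a < k" "k \<le> Suc b" by auto
    show ?case
      unfolding p(1) using inv_on_comp_rotation[OF p(3,4,2)] by (simp add: power_add)
  qed
  finally show ?thesis
    by (simp add: weight_def)
qed

text \<open>The finite q-Pochhammer symbol (q; q)_m.\<close>

definition phi :: "real \<Rightarrow> nat \<Rightarrow> real" where
  "phi q m = (\<Prod>k=1..m. 1 - q ^ k)"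

text \<open>The total weight is the q-factorial of the length, with factors (1 - q ^ k) / (1 -
  q).\<close>

lemma weight_interval:
  assumes "q \<noteq> 1" "a \<le> b"
  shows "weight q {a<..b} UNIV = phi q (b - a) / (1 - q) ^ (b - a)"
  using assms(2)
proof (induction b rule: dec_induct)
  case base
  have "{\<pi>. \<pi> permutes {a<..a}} = {id}"
    by auto
  then show ?case
    by (simp add: weight_def phi_def inv_on_def)
next
  case (step b)
  have "(\<Sum>i\<le>b - a. q ^ i) = (1 - q ^ Suc (b - a)) / (1 - q)"
    using assms(1) sum_gp0[of q "b - a"] by simp
  then show ?case
    using step weight_Suc[of a b q] assms(1) by (simp add: Suc_diff_le phi_def)
qed

section \<open>The limit of the product for q < 1\<close>

context
  fixes q :: real
  assumes q: "0 < q" "q < 1"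
begin

lemma phi_pos: "phi q m > 0"
  unfolding phi_def using q by (intro prod_pos) (simp add: power_less_one_iff)

lemma phi_decseq: "decseq (phi q)"
proof (rule decseq_SucI)
  fix m
  have "phi q (Suc m) = phi q m * (1 - q ^ Suc m)"
    by (simp add: phi_def)
  also have "\<dots> \<le> phi q m * 1"
    using q phi_pos[of m] by (intro mult_left_mono) auto
  finally show "phi q (Suc m) \<le> phi q m" by simp
qed

text \<open>From 1 / (1 - x) = 1 + x / (1 - x) \<le> exp (x / (1 - x)) with x = q ^ k \<le> q, each
  factor is at least exp (- x / (1 - q)); the exponents form a geometric series.\<close>

lemma phi_bounded_below: "phi q m \<ge> exp (- (1 / (1 - q)\<^sup>2))"
proof -
  have "1 - q ^ k \<ge> exp (- (q ^ k / (1 - q)))" if "k \<ge> 1" for k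
  proof -
    have qk: "0 < q ^ k" "q ^ k \<le> q"
      using q that power_decreasing[of 1 k q] by auto
    have "1 / (1 - q ^ k) = 1 + q ^ k / (1 - q ^ k)"
      using qk q by (simp add: field_simps)
    also have "\<dots> \<le> exp (q ^ k / (1 - q ^ k))"
      by (rule exp_ge_add_one_self)
    also have "\<dots> \<le> exp (q ^ k / (1 - q))"
      using qk q by (simp add: frac_le)
    finally show ?thesis
      using qk q by (simp add: exp_minus field_simps)
  qed
  then have "(\<Prod>k=1..m. exp (- (q ^ k / (1 - q)))) \<le> phi q m"
    unfolding phi_def by (intro prod_mono) auto
  also have "(\<Prod>k=1..m. exp (- (q ^ k / (1 - q)))) = exp (- ((\<Sum>k=1..m. q ^ k) / (1 - q)))"
    by (simp add: exp_sum[symmetric] sum_negf sum_divide_distrib)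
  finally have *: "exp (- ((\<Sum>k=1..m. q ^ k) / (1 - q))) \<le> phi q m" .
  have "(\<Sum>k=1..m. q ^ k) \<le> (\<Sum>k\<le>m. q ^ k)"
    using q by (intro sum_mono2) auto
  also have "\<dots> \<le> 1 / (1 - q)"
    using q sum_gp0[of q m] by (simp add: divide_right_mono)
  finally have "(\<Sum>k=1..m. q ^ k) / (1 - q) \<le> 1 / (1 - q) / (1 - q)"
    using q by (intro divide_right_mono) auto
  then have "(\<Sum>k=1..m. q ^ k) / (1 - q) \<le> 1 / (1 - q)\<^sup>2"
    by (simp add: power2_eq_square)
  then have "exp (- (1 / (1 - q)\<^sup>2)) \<le> exp (- ((\<Sum>k=1..m. q ^ k) / (1 - q)))"
    by simp
  with * show ?thesis by linarith
qed

text \<open>A decreasing sequence stays above its limit c throughout but is close to it only from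
  some s on. This s becomes the spacing of the blocks.\<close>

lemma phi_limit:
  obtains c where "c > 0" "\<And>m. c \<le> phi q m"
    "\<And>\<delta>. \<delta> > 0 \<Longrightarrow> \<exists>s>0. \<forall>m\<ge>s. phi q m \<le> c * (1 + \<delta>)"
proof -
  obtain c where c: "phi q \<longlonglongrightarrow> c" "\<And>m. c \<le> phi q m"
    using decseq_convergent[OF phi_decseq] phi_bounded_below by blast
  have "exp (- (1 / (1 - q)\<^sup>2)) \<le> c"
    by (rule LIMSEQ_le_const[OF c(1)]) (use phi_bounded_below in auto)
  then have "c > 0"
    by (meson exp_gt_zero less_le_trans)
  moreover have "\<exists>s>0. \<forall>m\<ge>s. phi q m \<le> c * (1 + \<delta>)" if "\<delta> > 0" for \<delta>
  proof -
    have "c < c * (1 + \<delta>)"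
      using that \<open>c > 0\<close> by simp
    then have "eventually (\<lambda>m. phi q m < c * (1 + \<delta>)) sequentially"
      by (rule order_tendstoD(2)[OF c(1)])
    then obtain s where "\<forall>m\<ge>s. phi q m < c * (1 + \<delta>)"
      by (auto simp: eventually_sequentially)
    then show ?thesis
      by (intro exI[of _ "Suc s"]) (auto intro: less_imp_le)
  qed
  ultimately show ?thesis
    using c(2) that by blast
qed

end

section \<open>Almost independent blocks and the case \<open>q < 1\<close>\<close>

text \<open>Chebyshev's inequality around T * p, which need not be the mean. The assumed bounds give
  a second moment of at most \<open>T + 3 * \<eta> * (T * p)\<^sup>2\<close>, and the event forces a
  deviation of at least T * p / 2; hence the constants 4 and 12.\<close>

lemma second_moment:
  fixes M :: "'a pmf" and X :: "nat \<Rightarrow> 'a set" and T :: nat and p \<eta> :: real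
  assumes p: "p > 0" and T: "T > 0" and \<eta>: "\<eta> \<ge> 0"
    and single: "\<And>t. t < T \<Longrightarrow> p * (1 - \<eta>) \<le> measure_pmf.prob M (X t)"
    and pair: "\<And>t u. t < u \<Longrightarrow> u < T \<Longrightarrow> measure_pmf.prob M (X t \<inter> X u) \<le> p\<^sup>2 * (1 + \<eta>)"
  shows "measure_pmf.prob M {\<omega>. card {t. t < T \<and> \<omega> \<in> X t} \<le> T * p / 2} \<le> 4 / (T * p\<^sup>2) + 12 * \<eta>"
proof -
  let ?\<mu> = "T * p"
  define S where "S \<omega> = (\<Sum>t<T. indicator (X t) \<omega> :: real)" for \<omega>
  have S_card: "S \<omega> = card {t. t < T \<and> \<omega> \<in> X t}" for \<omega>
  proof -
    have "{..<T} \<inter> {t. \<omega> \<in> X t} = {t. t < T \<and> \<omega> \<in> X t}"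
      by auto
    then show ?thesis
      by (simp add: S_def indicator_def sum.If_cases)
  qed
  have int: "integrable M (indicator A :: _ \<Rightarrow> real)" for A :: "'a set"
    by (intro measure_pmf.integrable_const_bound[of _ 1]) (auto simp: indicator_def)
  have expand: "(S \<omega> - ?\<mu>)\<^sup>2 = (\<Sum>t<T. \<Sum>u<T. indicator (X t \<inter> X u) \<omega>) - 2 * ?\<mu> * (\<Sum>t<T. indicator (X t) \<omega>) + ?\<mu>\<^sup>2" for \<omega>
  proof -
    have "(\<Sum>t<T. \<Sum>u<T. indicator (X t \<inter> X u) \<omega>) = S \<omega> * S \<omega>"
      unfolding S_def sum_product by (intro sum.cong refl) (simp add: indicator_inter_arith)
    then show ?thesis
      by (simp add: S_def power2_eq_square algebra_simps)
  qed
  have int_sq: "integrable M (\<lambda>\<omega>. (S \<omega> - ?\<mu>)\<^sup>2)"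
    unfolding expand by (intro Bochner_Integration.integrable_add Bochner_Integration.integrable_diff
      Bochner_Integration.integrable_sum integrable_mult_right int) simp
  have "(\<integral>\<omega>. (S \<omega> - ?\<mu>)\<^sup>2 \<partial>measure_pmf M) =
      (\<Sum>t<T. \<Sum>u<T. measure_pmf.prob M (X t \<inter> X u)) - 2 * ?\<mu> * (\<Sum>t<T. measure_pmf.prob M (X t)) + ?\<mu>\<^sup>2"
    unfolding expand by (simp add: int)
  \<comment> \<open>The summand 1 pays for the diagonal, where only the trivial bound is
    available.\<close>
  also have "(\<Sum>t<T. \<Sum>u<T. measure_pmf.prob M (X t \<inter> X u)) \<le>
      (\<Sum>t<T. \<Sum>u<T. (if u = t then 1 else 0) + p\<^sup>2 * (1 + \<eta>))"
  proof (intro sum_mono)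
    fix t u assume tu: "t \<in> {..<T}" "u \<in> {..<T}"
    have nonneg: "0 \<le> p\<^sup>2 * (1 + \<eta>)"
      using \<eta> by simp
    consider "t = u" | "t < u" | "u < t"
      by linarith
    then show "measure_pmf.prob M (X t \<inter> X u) \<le> (if u = t then 1 else 0) + p\<^sup>2 * (1 + \<eta>)"
    proof cases
      case 1
      then show ?thesis
        using nonneg order_trans[OF measure_pmf.prob_le_1[of M "X t \<inter> X u"], of "1 + p\<^sup>2 * (1 + \<eta>)"]
        by simp
    next
      case 2
      then show ?thesis
        using pair[of t u] tu by simp
    next
      case 3
      then show ?thesis
        using pair[of u t] tu by (simp add: Int_commute)
    qed
  qed
  also have "\<dots> = real T + real T * (real T * (p\<^sup>2 * (1 + \<eta>)))"
    by (simp add: sum.distrib distrib_left)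
  finally have E1: "(\<integral>\<omega>. (S \<omega> - ?\<mu>)\<^sup>2 \<partial>measure_pmf M) \<le>
      real T + real T * (real T * (p\<^sup>2 * (1 + \<eta>))) - 2 * ?\<mu> * (\<Sum>t<T. measure_pmf.prob M (X t)) + ?\<mu>\<^sup>2"
    by simp
  have "real T * (p * (1 - \<eta>)) \<le> (\<Sum>t<T. measure_pmf.prob M (X t))"
    using sum_mono[of "{..<T}" "\<lambda>_. p * (1 - \<eta>)" "\<lambda>t. measure_pmf.prob M (X t)"] single by simp
  then have "2 * ?\<mu> * (real T * (p * (1 - \<eta>))) \<le> 2 * ?\<mu> * (\<Sum>t<T. measure_pmf.prob M (X t))"
    using p by (intro mult_left_mono) auto
  with E1 have "(\<integral>\<omega>. (S \<omega> - ?\<mu>)\<^sup>2 \<partial>measure_pmf M) \<le>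
      real T + real T * (real T * (p\<^sup>2 * (1 + \<eta>))) - 2 * ?\<mu> * (real T * (p * (1 - \<eta>))) + ?\<mu>\<^sup>2"
    by linarith
  also have "\<dots> = real T + 3 * \<eta> * ?\<mu>\<^sup>2"
    by (simp add: algebra_simps power2_eq_square)
  finally have E: "(\<integral>\<omega>. (S \<omega> - ?\<mu>)\<^sup>2 \<partial>measure_pmf M) \<le> real T + 3 * \<eta> * ?\<mu>\<^sup>2" .
  have "measure_pmf.prob M {\<omega>. card {t. t < T \<and> \<omega> \<in> X t} \<le> ?\<mu> / 2} =
      (\<integral>\<omega>. indicator {\<omega>. card {t. t < T \<and> \<omega> \<in> X t} \<le> ?\<mu> / 2} \<omega> \<partial>measure_pmf M)"
    by simp
  also have "\<dots> \<le> (\<integral>\<omega>. 4 / ?\<mu>\<^sup>2 * (S \<omega> - ?\<mu>)\<^sup>2 \<partial>measure_pmf M)"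
  proof (intro integral_mono integrable_mult_right int_sq int)
    fix \<omega>
    have "1 \<le> 4 / ?\<mu>\<^sup>2 * (S \<omega> - ?\<mu>)\<^sup>2" if "S \<omega> \<le> ?\<mu> / 2"
    proof -
      have "(?\<mu> / 2)\<^sup>2 \<le> (?\<mu> - S \<omega>)\<^sup>2"
        using that p T by (intro power_mono) (auto simp: mult.commute)
      also have "\<dots> = (S \<omega> - ?\<mu>)\<^sup>2"
        by (rule power2_commute)
      finally show ?thesis
        using p T by (simp add: power_divide field_simps)
    qed
    then show "indicator {\<omega>. card {t. t < T \<and> \<omega> \<in> X t} \<le> ?\<mu> / 2} \<omega> \<le> 4 / ?\<mu>\<^sup>2 * (S \<omega> - ?\<mu>)\<^sup>2"
      by (auto simp: indicator_def S_card)
  qed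
  also have "\<dots> = 4 / ?\<mu>\<^sup>2 * (\<integral>\<omega>. (S \<omega> - ?\<mu>)\<^sup>2 \<partial>measure_pmf M)"
    by simp
  also have "\<dots> \<le> 4 / ?\<mu>\<^sup>2 * (real T + 3 * \<eta> * ?\<mu>\<^sup>2)"
    using E by (intro mult_left_mono) auto
  also have "\<dots> = 4 / (T * p\<^sup>2) + 12 * \<eta>"
    using p T by (simp add: field_simps power2_eq_square)
  finally show ?thesis .
qed

text \<open>The middle interval from a to b is preserved along with the parts on both sides of it.
  The slots E and F admit blocks inside and to the right of a block, and m is a free origin for
  those.\<close>

definition block ::
  "nat \<Rightarrow> nat \<Rightarrow> nat \<Rightarrow> nat \<Rightarrow> (nat \<Rightarrow> nat) set \<Rightarrow> (nat \<Rightarrow> nat) set \<Rightarrow> (nat \<Rightarrow> nat) set" where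
  "block m a b n E F = direct_sum {m<..a} UNIV {a<..n} (direct_sum {a<..b} E {b<..n} F)"

lemma restrict_id_nested: "B \<subseteq> A \<Longrightarrow> restrict_id (restrict_id \<pi> A) B = restrict_id \<pi> B"
  by (auto simp: restrict_id_def fun_eq_iff)

lemma image_restrict_id: "B \<subseteq> A \<Longrightarrow> restrict_id \<pi> A ` B = \<pi> ` B"
  by (intro image_cong) (auto simp: restrict_id_def)

lemma mem_direct_sum_restrict:
  assumes "A \<subseteq> C" "B \<subseteq> C"
  shows "restrict_id \<pi> C \<in> direct_sum A E B F \<longleftrightarrow> \<pi> \<in> direct_sum A E B F"
  using assms by (simp add: direct_sum_def restrict_id_nested image_restrict_id)

lemma mem_block_iff:
  assumes "a \<le> b" "b \<le> n"
  shows "\<pi> \<in> block m a b n E F \<longleftrightarrow> \<pi> ` {m<..a} = {m<..a} \<and> \<pi> ` {a<..b} = {a<..b} \<and>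
     restrict_id \<pi> {a<..b} \<in> E \<and> restrict_id \<pi> {b<..n} \<in> F"
proof -
  have "{a<..b} \<subseteq> {a<..n}" "{b<..n} \<subseteq> {a<..n}"
    using assms by auto
  then show ?thesis
    unfolding block_def direct_sum_def[of "{m<..a}"]
    by (simp add: mem_direct_sum_restrict) (simp add: direct_sum_def)
qed

lemma mem_block_restrict:
  assumes "m \<le> a" "a \<le> b" "b \<le> n"
  shows "restrict_id \<pi> {m<..n} \<in> block m a b n E F \<longleftrightarrow> \<pi> \<in> block m a b n E F"
  unfolding block_def using assms by (intro mem_direct_sum_restrict) auto

lemma weight_block:
  assumes "m \<le> a" "a \<le> b" "b \<le> n"
  shows "weight q {m<..n} (block m a b n E F) = weight q {m<..a} UNIV * (weight q {a<..b} E * weight q {b<..n} F)"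
proof -
  have 1: "{m<..n} = {m<..a} \<union> {a<..n}" "{a<..n} = {a<..b} \<union> {b<..n}"
    using assms by auto
  have "weight q {m<..n} (block m a b n E F) = weight q {m<..a} UNIV * weight q {a<..n} (direct_sum {a<..b} E {b<..n} F)"
    unfolding block_def by (subst 1(1)) (rule weight_direct_sum; auto)
  also have "weight q {a<..n} (direct_sum {a<..b} E {b<..n} F) = weight q {a<..b} E * weight q {b<..n} F"
    by (subst 1(2)) (rule weight_direct_sum; auto)
  finally show ?thesis .
qed

text \<open>Places the intersection in one iterated direct sum, whose weight factorizes. The gap
  from b to a' is preserved as a difference of preserved initial segments. An inclusion suffices for
  an upper bound on pairs.\<close>

lemma block_inter_sequential:
  assumes le: "a \<le> b" "b \<le> a'" "a' \<le> b'" "b' \<le> n" and \<pi>: "\<pi> permutes {0<..n}"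
    and mem: "\<pi> \<in> block 0 a b n E UNIV" "\<pi> \<in> block 0 a' b' n E' UNIV"
  shows "\<pi> \<in> block 0 a b n E (block b a' b' n E' UNIV)"
proof -
  have pres: "\<pi> ` {0<..a} = {0<..a}" "\<pi> ` {a<..b} = {a<..b}" "\<pi> ` {0<..a'} = {0<..a'}"
    using mem le by (simp_all add: mem_block_iff)
  have "\<pi> ` {0<..b} = {0<..b}"
    using pres(1,2) image_Un[of \<pi> "{0<..a}" "{a<..b}"] le by (simp add: ivl_disj_un)
  moreover have "{b<..a'} = {0<..a'} - {0<..b}"
    by auto
  ultimately have "\<pi> ` {b<..a'} = {b<..a'}"
    using image_Diff_permutes[OF \<pi> _ pres(3), of "{0<..b}"] by simp
  then have "\<pi> \<in> block b a' b' n E' UNIV"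
    using mem le by (simp add: mem_block_iff)
  then have "restrict_id \<pi> {b<..n} \<in> block b a' b' n E' UNIV"
    using le by (simp add: mem_block_restrict)
  then show ?thesis
    using mem(1) le by (simp add: mem_block_iff[of a b])
qed

text \<open>Here the second block lies inside the first, and the left margin from a to a' is the
  difference of preserved initial segments.\<close>

lemma block_inter_nested:
  assumes le: "a \<le> a'" "a' \<le> b'" "b' \<le> b" "b \<le> n" and \<pi>: "\<pi> permutes {0<..n}"
    and mem: "\<pi> \<in> block 0 a b n UNIV UNIV" "\<pi> \<in> block 0 a' b' n UNIV UNIV"
  shows "\<pi> \<in> block 0 a b n (block a a' b' b UNIV UNIV) UNIV"
proof -
  have pres: "\<pi> ` {0<..a} = {0<..a}" "\<pi> ` {0<..a'} = {0<..a'}"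
    using mem le by (simp_all add: mem_block_iff)
  have "{a<..a'} = {0<..a'} - {0<..a}"
    by auto
  then have "\<pi> ` {a<..a'} = {a<..a'}"
    using image_Diff_permutes[OF \<pi> pres] by simp
  then have "\<pi> \<in> block a a' b' b UNIV UNIV"
    using mem le by (simp add: mem_block_iff)
  then have "restrict_id \<pi> {a<..b} \<in> block a a' b' b UNIV UNIV"
    using le by (simp add: mem_block_restrict)
  then show ?thesis
    using mem(1) le by (simp add: mem_block_iff[of a b])
qed

lemma prob_mallows_weight:
  assumes "q > 0"
  shows "measure_pmf.prob (mallows n q) E = weight q {0<..n} E / weight q {0<..n} UNIV"
  unfolding prob_mallows[OF assms] weight_def inversions_eq_inv_on
  by (simp add: atLeastSucAtMost_greaterThanAtMost)

lemma prob_mallows_mono: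
  assumes "q > 0" "\<And>\<pi>. \<pi> permutes {0<..n} \<Longrightarrow> \<pi> \<in> E \<Longrightarrow> \<pi> \<in> F"
  shows "measure_pmf.prob (mallows n q) E \<le> measure_pmf.prob (mallows n q) F"
proof (rule measure_pmf.finite_measure_mono_AE)
  show "AE \<pi> in mallows n q. \<pi> \<in> E \<longrightarrow> \<pi> \<in> F"
    using assms by (auto simp: AE_measure_pmf_iff set_pmf_eq pmf_mallows
      atLeastSucAtMost_greaterThanAtMost split: if_splits)
qed simp

text \<open>The pattern prescribed on a block to produce period l, chosen because its inversions are
  easy to count.\<close>

definition cyclic_block :: "nat \<Rightarrow> nat \<Rightarrow> nat \<Rightarrow> nat" where
  "cyclic_block a l = cycle_of_list [Suc a..<Suc (a + l)]"

lemma cyclic_block_permutes: "cyclic_block a l permutes {a<..a + l}"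
proof -
  have "set [Suc a..<Suc (a + l)] = {a<..a + l}"
    by auto
  then show ?thesis
    unfolding cyclic_block_def by (metis cycle_permutes)
qed

lemma cyclic_block_apply:
  assumes "i < l"
  shows "cyclic_block a l (Suc (a + i)) = (if Suc i = l then Suc a else Suc (Suc (a + i)))"
proof -
  let ?xs = "[Suc a..<Suc (a + l)]"
  have nth: "?xs ! j = Suc (a + j)" if "j < l" for j
    using that by (simp del: upt_Suc)
  have "cyclic_block a l (?xs ! i) = ?xs ! (Suc i mod l)"
    using funpow_cycle_of_list_nth[of ?xs i 1] assms by (simp add: cyclic_block_def del: upt_Suc)
  moreover have "Suc i mod l = (if Suc i = l then 0 else Suc i)"
    using assms by auto
  ultimately show ?thesis
    using assms nth[of i] nth[of 0] nth[of "Suc i"] by (auto split: if_splits)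
qed

text \<open>All positions but the last are shifted up in order; the last receives the smallest value
  and is inverted with each of the others.\<close>

lemma inv_on_cyclic_block: "inv_on {a<..a + l} (cyclic_block a l) = l - 1"
proof -
  have "{(i, j). i \<in> {a<..a + l} \<and> j \<in> {a<..a + l} \<and> i < j \<and> cyclic_block a l i > cyclic_block a l j} =
      (\<lambda>i. (i, a + l)) ` {a<..<a + l}"
  proof (intro equalityI subsetI)
    fix p assume "p \<in> {(i, j). i \<in> {a<..a + l} \<and> j \<in> {a<..a + l} \<and> i < j \<and> cyclic_block a l i > cyclic_block a l j}"
    then obtain i j where p: "p = (i, j)" "a < i" "i < j" "j \<le> a + l" "cyclic_block a l i > cyclic_block a l j"
      by auto
    define i' j' where "i' = i - Suc a" and "j' = j - Suc a"
    have "i = Suc (a + i')" "j = Suc (a + j')" "i' < j'" "j' < l"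
      using p by (auto simp: i'_def j'_def)
    then show "p \<in> (\<lambda>i. (i, a + l)) ` {a<..<a + l}"
      using p cyclic_block_apply[of i' l a] cyclic_block_apply[of j' l a] by (auto split: if_splits)
  next
    fix p assume "p \<in> (\<lambda>i. (i, a + l)) ` {a<..<a + l}"
    then obtain i where i: "p = (i, a + l)" "a < i" "i < a + l"
      by auto
    define i' where "i' = i - Suc a"
    have "i = Suc (a + i')" "Suc i' < l" "a + l = Suc (a + (l - 1))"
      using i by (auto simp: i'_def)
    then show "p \<in> {(i, j). i \<in> {a<..a + l} \<and> j \<in> {a<..a + l} \<and> i < j \<and> cyclic_block a l i > cyclic_block a l j}"
      using i cyclic_block_apply[of i' l a] cyclic_block_apply[of "l - 1" l a] by auto
  qed
  then show ?thesis
    unfolding inv_on_def by (simp add: card_image inj_on_def)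
qed

lemma weight_cyclic_block: "weight q {a<..a + l} {cyclic_block a l} = q ^ (l - 1)"
proof -
  have "{\<pi>. \<pi> permutes {a<..a + l} \<and> \<pi> \<in> {cyclic_block a l}} = {cyclic_block a l}"
    using cyclic_block_permutes by auto
  then show ?thesis
    by (simp add: weight_def inv_on_cyclic_block)
qed

text \<open>The fifth power comes from the five intervals cut out by two nested blocks. As \<delta>
  \<le> 1, its powers are at most \<delta>, and the binomial coefficients besides the constant term
  sum to 2 ^ 5 - 1 = 31.\<close>

lemma exists_small_error:
  assumes "0 < (\<eta>::real)" "\<eta> \<le> 1"
  obtains \<delta> where "\<delta> > 0" "(1 + \<delta>) ^ 5 \<le> 1 + \<eta>" "1 - \<eta> \<le> 1 / (1 + \<delta>)"
proof
  define \<delta> where "\<delta> = \<eta> / 31"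
  have \<delta>: "0 < \<delta>" "\<delta> \<le> 1"
    using assms by (auto simp: \<delta>_def)
  have pow: "\<delta> ^ k \<le> \<delta>" if "k \<ge> 1" for k
    using power_decreasing[of 1 k \<delta>] that \<delta> by simp
  have "(1 + \<delta>) ^ 5 = 1 + 5 * \<delta> + 10 * \<delta> ^ 2 + 10 * \<delta> ^ 3 + 5 * \<delta> ^ 4 + \<delta> ^ 5"
    by (simp add: power_numeral_reduce algebra_simps)
  also have "\<dots> \<le> 1 + 31 * \<delta>"
    using pow[of 2] pow[of 3] pow[of 4] pow[of 5] by simp
  finally show "(1 + \<delta>) ^ 5 \<le> 1 + \<eta>"
    by (simp add: \<delta>_def)
  have "(1 - \<eta>) * (1 + \<delta>) \<le> 1"
    using assms by (simp add: \<delta>_def field_simps)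
  then show "1 - \<eta> \<le> 1 / (1 + \<delta>)"
    using \<delta> by (simp add: field_simps)
  show "\<delta> > 0" by fact
qed

lemma cyclic_block_period:
  assumes "\<pi> \<in> block 0 a (a + l) n {cyclic_block a l} UNIV" "a + l \<le> n" "l > 0"
  shows "Suc a \<in> with_period {1..n} \<pi> l"
proof -
  have r: "restrict_id \<pi> {a<..a + l} = cyclic_block a l"
    using assms by (simp add: mem_block_iff)
  have "least_power \<pi> (Suc a) = least_power (cyclic_block a l) (Suc a)"
  proof (rule least_power_cong_on[of "{a<..a + l}"])
    show "\<pi> y = cyclic_block a l y" if "y \<in> {a<..a + l}" for y
      using that unfolding r[symmetric] by simp
    show "cyclic_block a l y \<in> {a<..a + l}" if "y \<in> {a<..a + l}" for y
      using that permutes_in_image[OF cyclic_block_permutes] by blast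
  qed (use assms in simp)
  also have "\<dots> = l"
    using least_power_cycle_of_list[of "[Suc a..<Suc (a + l)]" "Suc a"] assms(3)
    by (simp add: cyclic_block_def del: upt_Suc)
  finally show ?thesis
    using assms by (simp add: with_period_def)
qed

section \<open>Probabilities of block events for q < 1\<close>

context
  fixes q :: real
  assumes q: "0 < q" "q < 1"
begin

lemma weight_UNIV: "a \<le> b \<Longrightarrow> weight q {a<..b} UNIV = phi q (b - a) / (1 - q) ^ (b - a)"
  using q by (intro weight_interval) auto

text \<open>The powers of 1 - q cancel because the lengths of the three parts sum to n; on the
  middle part the power is kept to normalize the weight of E.\<close>

lemma prob_block:
  assumes "a \<le> b" "b \<le> n"
  shows "measure_pmf.prob (mallows n q) (block 0 a b n E UNIV) =
    phi q a * (weight q {a<..b} E * (1 - q) ^ (b - a)) * phi q (n - b) / phi q n"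
proof -
  have "(1 - q) ^ n = (1 - q) ^ a * (1 - q) ^ (b - a) * (1 - q) ^ (n - b)"
    using assms by (simp flip: power_add)
  then show ?thesis
    using assms q by (simp add: prob_mallows_weight weight_block weight_UNIV)
qed

lemma prob_block_inter_sequential:
  assumes "a \<le> b" "b \<le> a'" "a' \<le> b'" "b' \<le> n"
  shows "measure_pmf.prob (mallows n q) (block 0 a b n E UNIV \<inter> block 0 a' b' n E' UNIV) \<le>
    phi q a * (weight q {a<..b} E * (1 - q) ^ (b - a)) * phi q (a' - b) *
    (weight q {a'<..b'} E' * (1 - q) ^ (b' - a')) * phi q (n - b') / phi q n"
proof -
  have "measure_pmf.prob (mallows n q) (block 0 a b n E UNIV \<inter> block 0 a' b' n E' UNIV) \<le>
      measure_pmf.prob (mallows n q) (block 0 a b n E (block b a' b' n E' UNIV))"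
    using q(1) assms by (intro prob_mallows_mono block_inter_sequential) auto
  also have "\<dots> = phi q a * (weight q {a<..b} E * (1 - q) ^ (b - a)) * phi q (a' - b) *
    (weight q {a'<..b'} E' * (1 - q) ^ (b' - a')) * phi q (n - b') / phi q n"
  proof -
    have "(1 - q) ^ n = (1 - q) ^ a * (1 - q) ^ (b - a) * (1 - q) ^ (a' - b) * (1 - q) ^ (b' - a') * (1 - q) ^ (n - b')"
      using assms by (simp flip: power_add)
    then show ?thesis
      using assms q by (simp add: prob_mallows_weight weight_block weight_UNIV)
  qed
  finally show ?thesis .
qed

lemma prob_block_inter_nested:
  assumes "a \<le> a'" "a' \<le> b'" "b' \<le> b" "b \<le> n"
  shows "measure_pmf.prob (mallows n q) (block 0 a b n UNIV UNIV \<inter> block 0 a' b' n UNIV UNIV) \<le>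
    phi q a * phi q (a' - a) * phi q (b' - a') * phi q (b - b') * phi q (n - b) / phi q n"
proof -
  have "measure_pmf.prob (mallows n q) (block 0 a b n UNIV UNIV \<inter> block 0 a' b' n UNIV UNIV) \<le>
      measure_pmf.prob (mallows n q) (block 0 a b n (block a a' b' b UNIV UNIV) UNIV)"
    using q(1) assms by (intro prob_mallows_mono block_inter_nested) auto
  also have "\<dots> = phi q a * phi q (a' - a) * phi q (b' - a') * phi q (b - b') * phi q (n - b) / phi q n"
  proof -
    have "(1 - q) ^ n = (1 - q) ^ a * (1 - q) ^ (a' - a) * (1 - q) ^ (b' - a') * (1 - q) ^ (b - b') * (1 - q) ^ (n - b)"
      using assms by (simp flip: power_add)
    then show ?thesis
      using assms q by (simp add: prob_mallows_weight weight_block weight_UNIV)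
  qed
  finally show ?thesis .
qed

lemma phi_almost_constant:
  assumes "0 < \<eta>" "\<eta> \<le> 1"
  obtains c \<delta> s where "0 < c" "0 < \<delta>" "(1 + \<delta>) ^ 5 \<le> 1 + \<eta>" "1 - \<eta> \<le> 1 / (1 + \<delta>)" "0 < s"
    "\<And>m. c \<le> phi q m" "\<And>m. m \<ge> s \<Longrightarrow> phi q m \<le> c * (1 + \<delta>)"
  using phi_limit[OF q] exists_small_error[OF assms] by metis

end

context
  fixes q :: real
  assumes q: "0 < q" "q < 1"
begin

text \<open>T blocks at distance at least s from each other and from both ends each carry the
  l-cycle with probability about p = w * c: the two outer factors and the denominator are all about
  c. Each successful block contributes an element of period l.\<close>

lemma many_cyclic_blocks:
  assumes l: "l > 0" and \<epsilon>: "\<epsilon> > 0"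
  shows "\<forall>\<^sub>F n in sequentially.
    measure_pmf.prob (mallows n q) {\<pi>. card (with_period {1..n} \<pi> l) \<le> K} \<le> \<epsilon>"
proof -
  define \<eta> where "\<eta> = min 1 (\<epsilon> / 24)"
  have \<eta>: "0 < \<eta>" "\<eta> \<le> 1" "12 * \<eta> \<le> \<epsilon> / 2"
    using \<epsilon> by (auto simp: \<eta>_def)
  obtain c \<delta> s where c: "0 < c" "0 < \<delta>" "(1 + \<delta>) ^ 5 \<le> 1 + \<eta>" "1 - \<eta> \<le> 1 / (1 + \<delta>)" "0 < s"
    and phi: "\<And>m. c \<le> phi q m" "\<And>m. m \<ge> s \<Longrightarrow> phi q m \<le> c * (1 + \<delta>)"
    using phi_almost_constant[OF q \<eta>(1,2)] by blast
  define w where "w = q ^ (l - 1) * (1 - q) ^ l"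
  have w: "w > 0"
    using q by (simp add: w_def)
  define p where "p = w * c"
  have p: "p > 0"
    using w c by (simp add: p_def)
  \<comment> \<open>The first bound keeps one error term of the second moment below \<epsilon> / 2,
    the second makes T * p / 2 exceed K.\<close>
  obtain T :: nat where T: "max (8 / (\<epsilon> * p\<^sup>2)) (2 * K / p) < T"
    using reals_Archimedean2 by blast
  have T8: "4 / (T * p\<^sup>2) \<le> \<epsilon> / 2" and TK: "K < T * p / 2" and T0: "T > 0"
  proof -
    have "8 / (\<epsilon> * p\<^sup>2) < T" "2 * K / p < T"
      using T by auto
    moreover have "0 < 8 / (\<epsilon> * p\<^sup>2)"
      using \<epsilon> p by simp
    ultimately have "0 < real T"
      by linarith
    then show "T > 0" "4 / (T * p\<^sup>2) \<le> \<epsilon> / 2" "K < T * p / 2"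
      using \<open>8 / (\<epsilon> * p\<^sup>2) < T\<close> \<open>2 * K / p < T\<close> \<epsilon> p by (simp_all add: field_simps)
  qed
  define a where "a t = s + t * (s + l)" for t
  have a_gap: "a t + l + s \<le> a u" if "t < u" for t u
  proof -
    have "Suc t * (s + l) \<le> u * (s + l)"
      using that by (intro mult_right_mono) auto
    then show ?thesis
      by (simp add: a_def)
  qed
  have "measure_pmf.prob (mallows n q) {\<pi>. card (with_period {1..n} \<pi> l) \<le> K} \<le> \<epsilon>" if n: "n \<ge> a T" for n
  proof -
    define X where "X t = block 0 (a t) (a t + l) n {cyclic_block (a t) l} UNIV" for t
    have end_gap: "s \<le> n - (a t + l)" "a t + l \<le> n" if "t < T" for t
      using a_gap[OF that] n by auto
    have start: "s \<le> a t" for t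
      by (simp add: a_def)
    have single: "p * (1 - \<eta>) \<le> measure_pmf.prob (mallows n q) (X t)" if t: "t < T" for t
    proof -
      have "s \<le> n"
        using start[of t] end_gap[OF t] by simp
      have "p * (1 - \<eta>) \<le> p * (1 / (1 + \<delta>))"
        using c(4) p by (intro mult_left_mono) auto
      also have "\<dots> = c * w * c / (c * (1 + \<delta>))"
        using c by (simp add: p_def)
      also have "\<dots> \<le> phi q (a t) * w * phi q (n - (a t + l)) / phi q n"
        using phi(1)[of "a t"] phi(1)[of "n - (a t + l)"] phi(2)[OF \<open>s \<le> n\<close>] c w phi_pos[OF q]
        by (intro frac_le mult_mono) (auto intro: less_imp_le)
      also have "\<dots> = measure_pmf.prob (mallows n q) (X t)"
        using prob_block[OF q, of "a t" "a t + l" n] end_gap[OF t]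
        by (simp add: X_def weight_cyclic_block w_def)
      finally show ?thesis .
    qed
    have pair: "measure_pmf.prob (mallows n q) (X t \<inter> X u) \<le> p\<^sup>2 * (1 + \<eta>)" if tu: "t < u" "u < T" for t u
    proof -
      have gap: "s \<le> a u - (a t + l)" "a t + l \<le> a u"
        using a_gap[OF tu(1)] by auto
      have "measure_pmf.prob (mallows n q) (X t \<inter> X u) \<le>
          phi q (a t) * w * phi q (a u - (a t + l)) * w * phi q (n - (a u + l)) / phi q n"
        using prob_block_inter_sequential[OF q, of "a t" "a t + l" "a u" "a u + l" n
            "{cyclic_block (a t) l}" "{cyclic_block (a u) l}"] gap end_gap[OF tu(2)]
        by (simp add: X_def weight_cyclic_block w_def)
      also have "\<dots> \<le> (c * (1 + \<delta>)) * w * (c * (1 + \<delta>)) * w * (c * (1 + \<delta>)) / c"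
        using phi(2)[OF start[of t]] phi(2)[OF gap(1)] phi(2)[OF end_gap(1)[OF tu(2)]] phi(1)[of n] c w
          phi_pos[OF q]
        by (intro frac_le mult_mono mult_nonneg_nonneg) (auto intro: less_imp_le)
      also have "\<dots> = p\<^sup>2 * (1 + \<delta>) ^ 3"
        using c by (simp add: p_def power2_eq_square power3_eq_cube)
      also have "\<dots> \<le> p\<^sup>2 * (1 + \<eta>)"
        using c(2) by (intro mult_left_mono order_trans[OF power_increasing c(3)]) auto
      finally show ?thesis .
    qed
    have "card {t. t < T \<and> \<pi> \<in> X t} \<le> card (with_period {1..n} \<pi> l)" for \<pi>
    proof (rule card_inj_on_le[of "\<lambda>t. Suc (a t)"])
      show "inj_on (\<lambda>t. Suc (a t)) {t. t < T \<and> \<pi> \<in> X t}"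
        using a_gap l by (intro inj_onI) (metis add_leD1 le_antisym less_irrefl nat_neq_iff
            less_add_same_cancel1 order_less_le_trans Suc_inject)
      show "(\<lambda>t. Suc (a t)) ` {t. t < T \<and> \<pi> \<in> X t} \<subseteq> with_period {1..n} \<pi> l"
        using end_gap l cyclic_block_period unfolding X_def by blast
    qed (simp add: with_period_def)
    then have "card {t. t < T \<and> \<pi> \<in> X t} \<le> T * p / 2" if "card (with_period {1..n} \<pi> l) \<le> K" for \<pi>
      using that TK by (meson less_imp_le of_nat_mono order_trans)
    then have "measure_pmf.prob (mallows n q) {\<pi>. card (with_period {1..n} \<pi> l) \<le> K} \<le>
        measure_pmf.prob (mallows n q) {\<pi>. card {t. t < T \<and> \<pi> \<in> X t} \<le> T * p / 2}"
      by (intro measure_pmf.finite_measure_mono Collect_mono impI) auto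
    also have "\<dots> \<le> 4 / (T * p\<^sup>2) + 12 * \<eta>"
      using p T0 less_imp_le[OF \<eta>(1)] single pair by (rule second_moment)
    also have "\<dots> \<le> \<epsilon>"
      using T8 \<eta>(3) by simp
    finally show ?thesis .
  qed
  then show ?thesis
    by (rule eventually_sequentiallyI)
qed

text \<open>The candidates are intervals symmetric about the centre, nested at distance s. Each is
  preserved with probability about \<open>p = c\<^sup>2\<close>, three factors of about c over one.
  Since T and s are chosen before n, so is D.\<close>

lemma central_block:
  assumes \<epsilon>: "\<epsilon> > 0"
  obtains D where "\<forall>\<^sub>F n in sequentially.
    1 - \<epsilon> \<le> measure_pmf.prob (mallows n q) {\<pi>. \<exists>a. a \<le> n - a \<and> n - 2 * a \<le> D \<and> \<pi> \<in> block 0 a (n - a) n UNIV UNIV}"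
proof -
  define \<eta> where "\<eta> = min 1 (\<epsilon> / 24)"
  have \<eta>: "0 < \<eta>" "\<eta> \<le> 1" "12 * \<eta> \<le> \<epsilon> / 2"
    using \<epsilon> by (auto simp: \<eta>_def)
  obtain c \<delta> s where c: "0 < c" "0 < \<delta>" "(1 + \<delta>) ^ 5 \<le> 1 + \<eta>" "1 - \<eta> \<le> 1 / (1 + \<delta>)" "0 < s"
    and phi: "\<And>m. c \<le> phi q m" "\<And>m. m \<ge> s \<Longrightarrow> phi q m \<le> c * (1 + \<delta>)"
    using phi_almost_constant[OF q \<eta>(1,2)] by blast
  define p where "p = c\<^sup>2"
  have p: "p > 0"
    using c by (simp add: p_def)
  obtain T :: nat where T: "8 / (\<epsilon> * p\<^sup>2) < T"
    using reals_Archimedean2 by blast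
  have T8: "4 / (T * p\<^sup>2) \<le> \<epsilon> / 2" and T0: "T > 0"
  proof -
    have "0 < 8 / (\<epsilon> * p\<^sup>2)"
      using \<epsilon> p by simp
    then have "0 < real T"
      using T by linarith
    then show "T > 0" "4 / (T * p\<^sup>2) \<le> \<epsilon> / 2"
      using T \<epsilon> p by (simp_all add: field_simps)
  qed
  \<comment> \<open>The outermost candidate omits n div 2 - T * s points on each side; the 1 allows
    for odd n.\<close>
  define D where "D = 2 * T * s + 1"
  let ?E = "\<lambda>n. {\<pi>. \<exists>a. a \<le> n - a \<and> n - 2 * a \<le> D \<and> \<pi> \<in> block 0 a (n - a) n UNIV UNIV}"
  have "1 - \<epsilon> \<le> measure_pmf.prob (mallows n q) (?E n)" if n: "n \<ge> 2 * (T * s + s)" for n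
  proof -
    text \<open>The positions decrease with \<open>t\<close>, so that the blocks grow from the centre outwards.\<close>
    define a where "a t = n div 2 - Suc t * s" for t
    define X where "X t = block 0 (a t) (n - a t) n UNIV UNIV" for t
    have a: "s \<le> a t" "a t \<le> n - a t" "n - 2 * a t \<le> D" "s \<le> n - 2 * a t" "2 * a t \<le> n" if t: "t < T" for t
    proof -
      have *: "Suc t * s \<le> T * s" "s \<le> Suc t * s"
        using t by (auto intro!: mult_right_mono simp del: mult_Suc)
      have "T * s + s \<le> n div 2"
        using n by simp
      then have at: "a t + Suc t * s = n div 2"
        using * by (simp add: a_def)
      show "s \<le> a t" "a t \<le> n - a t" "n - 2 * a t \<le> D" "s \<le> n - 2 * a t" "2 * a t \<le> n"
        using at * \<open>T * s + s \<le> n div 2\<close> unfolding D_def by linarith+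
    qed
    have gap: "a u + s \<le> a t" if "t < u" "u < T" for t u
    proof -
      have "Suc (Suc t) * s \<le> Suc u * s" "Suc u * s \<le> T * s"
        using that by (auto intro!: mult_right_mono simp del: mult_Suc)
      moreover have "T * s + s \<le> n div 2"
        using n by simp
      ultimately show ?thesis
        by (simp add: a_def)
    qed
    have single: "p * (1 - \<eta>) \<le> measure_pmf.prob (mallows n q) (X t)" if t: "t < T" for t
    proof -
      have "s \<le> n"
        using a[OF t] by simp
      have "p * (1 - \<eta>) \<le> p * (1 / (1 + \<delta>))"
        using c(4) p by (intro mult_left_mono) auto
      also have "\<dots> = c * c * c / (c * (1 + \<delta>))"
        using c by (simp add: p_def power2_eq_square)
      also have "\<dots> \<le> phi q (a t) * phi q (n - a t - a t) * phi q (n - (n - a t)) / phi q n"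
        using phi(1) phi(2)[OF \<open>s \<le> n\<close>] c phi_pos[OF q]
        by (intro frac_le mult_mono mult_nonneg_nonneg) (auto intro: less_imp_le)
      also have "\<dots> = measure_pmf.prob (mallows n q) (X t)"
        using prob_block[OF q, of "a t" "n - a t" n UNIV] a[OF t] q
        by (simp add: X_def weight_UNIV[OF q])
      finally show ?thesis .
    qed
    have pair: "measure_pmf.prob (mallows n q) (X t \<inter> X u) \<le> p\<^sup>2 * (1 + \<eta>)" if tu: "t < u" "u < T" for t u
    proof -
      have t: "t < T" using tu by simp
      have g: "s \<le> a t - a u" "a u \<le> a t" "s \<le> n - a t - a t" "s \<le> n - a u - (n - a t)" "s \<le> n - (n - a u)"
        using gap[OF tu] a[OF t] a[OF tu(2)] by auto
      have "measure_pmf.prob (mallows n q) (X t \<inter> X u) \<le>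
          phi q (a u) * phi q (a t - a u) * phi q (n - a t - a t) * phi q (n - a u - (n - a t)) * phi q (n - (n - a u)) / phi q n"
        using prob_block_inter_nested[OF q, of "a u" "a t" "n - a t" "n - a u" n] g a[OF t] a[OF tu(2)]
          diff_le_mono2[OF g(2), of n]
        by (simp add: X_def Int_commute)
      \<comment> \<open>All five parts have length at least s, and five factors over one of at least
        c give \<open>c ^ 4 = p\<^sup>2\<close> up to \<open>(1 + \<delta>) ^ 5\<close>.\<close>
      also have "\<dots> \<le> (c * (1 + \<delta>)) * (c * (1 + \<delta>)) * (c * (1 + \<delta>)) * (c * (1 + \<delta>)) * (c * (1 + \<delta>)) / c"
        using phi(2)[OF a(1)[OF tu(2)]] phi(2)[OF g(1)] phi(2)[OF g(3)] phi(2)[OF g(4)] phi(2)[OF g(5)]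
          phi(1)[of n] c phi_pos[OF q]
        by (intro frac_le mult_mono mult_nonneg_nonneg) (auto intro: less_imp_le)
      also have "\<dots> = p\<^sup>2 * (1 + \<delta>) ^ 5"
        using c by (simp add: p_def power_numeral_reduce)
      also have "\<dots> \<le> p\<^sup>2 * (1 + \<eta>)"
        using c by (intro mult_left_mono) auto
      finally show ?thesis .
    qed
    have "1 - measure_pmf.prob (mallows n q) (?E n) = measure_pmf.prob (mallows n q) (- ?E n)"
      using measure_pmf.prob_compl[of "?E n" "mallows n q"] by (simp add: Compl_eq_Diff_UNIV)
    also have "\<dots> \<le> measure_pmf.prob (mallows n q) {\<pi>. card {t. t < T \<and> \<pi> \<in> X t} \<le> T * p / 2}"
    proof (intro measure_pmf.finite_measure_mono subsetI)
      fix \<pi> assume "\<pi> \<in> - ?E n"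
      then have "{t. t < T \<and> \<pi> \<in> X t} = {}"
        using a unfolding X_def by blast
      then show "\<pi> \<in> {\<pi>. card {t. t < T \<and> \<pi> \<in> X t} \<le> T * p / 2}"
        unfolding mem_Collect_eq using p by (simp only: card.empty) simp
    qed simp
    also have "\<dots> \<le> 4 / (T * p\<^sup>2) + 12 * \<eta>"
      using p T0 less_imp_le[OF \<eta>(1)] single pair by (rule second_moment)
    also have "\<dots> \<le> \<epsilon>"
      using T8 \<eta>(3) by simp
    finally show ?thesis by simp
  qed
  then have "\<forall>\<^sub>F n in sequentially. 1 - \<epsilon> \<le> measure_pmf.prob (mallows n q) (?E n)"
    by (rule eventually_sequentiallyI)
  then show ?thesis
    by (rule that)
qed

text \<open>Any two permutations rich in all periods up to c + 1 match, so \<phi> is constant on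
  them; the others have vanishing probability.\<close>

lemma mallows_zero_one_law: "zero_one_law (\<lambda>n. mallows n q)"
proof -
  let ?P = "\<lambda>n S. measure_pmf.prob (mallows n q) S"
  have limit: "\<exists>x\<in>{0, 1}. (\<lambda>n. ?P n {\<pi>. models n \<pi> \<phi>}) \<longlonglongrightarrow> x" if \<phi>: "sentence \<phi>" for \<phi>
  proof -
    obtain c where c: "\<And>n \<pi> m \<sigma>. \<lbrakk>\<pi> permutes {1..n}; \<sigma> permutes {1..m}; matching c {1..n} \<pi> {1..m} \<sigma>\<rbrakk>
      \<Longrightarrow> models n \<pi> \<phi> \<longleftrightarrow> models m \<sigma> \<phi>"
      using \<phi> by (rule models_matching) blast
    \<comment> \<open>Period Suc c provides the cycle longer than c that \<open>matching\<close>
      demands.\<close>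
    define rich where "rich n \<pi> \<longleftrightarrow> (\<forall>l\<in>{1..Suc c}. c < card (with_period {1..n} \<pi> l))"
      for n :: nat and \<pi> :: "nat \<Rightarrow> nat"
    have long: "\<exists>a\<in>{1..n}. c < least_power \<pi> a" if "rich n \<pi>" for n \<pi>
    proof -
      have "c < card (with_period {1..n} \<pi> (Suc c))"
        using that by (simp add: rich_def)
      then have "with_period {1..n} \<pi> (Suc c) \<noteq> {}"
        by auto
      then obtain a where "a \<in> {1..n}" "least_power \<pi> a = Suc c"
        by (auto simp: with_period_def)
      then show ?thesis
        by (intro bexI[of _ a]) auto
    qed
    have "matching c {1..n} \<pi> {1..m} \<sigma>" if "rich n \<pi>" "rich m \<sigma>" for n m \<pi> \<sigma>
      using that long[OF that(1)] long[OF that(2)] by (auto simp: matching_def rich_def intro: less_imp_le)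
    then have same: "models n \<pi> \<phi> \<longleftrightarrow> models m \<sigma> \<phi>"
      if "\<pi> permutes {1..n}" "\<sigma> permutes {1..m}" "rich n \<pi>" "rich m \<sigma>" for n m \<pi> \<sigma>
      using c that by blast
    have "(\<lambda>n. ?P n {\<pi>. card (with_period {1..n} \<pi> l) \<le> c}) \<longlonglongrightarrow> 0" if "l \<in> {1..Suc c}" for l
    proof (rule order_tendstoI)
      fix x :: real assume "x > 0"
      then show "\<forall>\<^sub>F n in sequentially. ?P n {\<pi>. card (with_period {1..n} \<pi> l) \<le> c} < x"
        using many_cyclic_blocks[of l "x / 2" c] that by (auto elim!: eventually_mono)
    next
      fix x :: real assume "x < 0"
      then show "\<forall>\<^sub>F n in sequentially. x < ?P n {\<pi>. card (with_period {1..n} \<pi> l) \<le> c}"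
        by (intro always_eventually allI) (auto intro: less_le_trans)
    qed
    then have "(\<lambda>n. \<Sum>l\<in>{1..Suc c}. ?P n {\<pi>. card (with_period {1..n} \<pi> l) \<le> c}) \<longlonglongrightarrow> (\<Sum>l\<in>{1..Suc c}. 0)"
      by (rule tendsto_sum)
    then have lim_sum: "(\<lambda>n. \<Sum>l\<in>{1..Suc c}. ?P n {\<pi>. card (with_period {1..n} \<pi> l) \<le> c}) \<longlonglongrightarrow> 0"
      by simp
    have poor: "?P n {\<pi>. \<not> rich n \<pi>} \<le> (\<Sum>l\<in>{1..Suc c}. ?P n {\<pi>. card (with_period {1..n} \<pi> l) \<le> c})" for n
    proof -
      have "{\<pi>. \<not> rich n \<pi>} = (\<Union>l\<in>{1..Suc c}. {\<pi>. card (with_period {1..n} \<pi> l) \<le> c})"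
        by (auto simp: rich_def not_less)
      then show ?thesis
        by (simp only:) (rule measure_pmf.finite_measure_subadditive_finite; simp)
    qed
    have lim_poor: "(\<lambda>n. ?P n {\<pi>. \<not> rich n \<pi>}) \<longlonglongrightarrow> 0"
      by (rule tendsto_sandwich[OF _ _ tendsto_const lim_sum]) (use poor in auto)
    have lim0: "(\<lambda>n. ?P n (S n)) \<longlonglongrightarrow> 0"
      if S: "\<And>n \<pi>. \<pi> permutes {1..n} \<Longrightarrow> \<pi> \<in> S n \<Longrightarrow> \<not> rich n \<pi>" for S
    proof (rule tendsto_sandwich[OF _ _ tendsto_const lim_poor])
      have "?P n (S n) \<le> ?P n {\<pi>. \<not> rich n \<pi>}" for n
      proof (rule prob_mallows_mono[OF q(1)])
        fix \<pi> assume "\<pi> permutes {0<..n}" "\<pi> \<in> S n"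
        moreover have "{0<..n} = {1..n}"
          by auto
        ultimately show "\<pi> \<in> {\<pi>. \<not> rich n \<pi>}"
          using S[of \<pi> n] by simp
      qed
      then show "\<forall>\<^sub>F n in sequentially. ?P n (S n) \<le> ?P n {\<pi>. \<not> rich n \<pi>}"
        by (intro always_eventually allI)
    qed simp
    show ?thesis
    \<comment> \<open>A single rich model of any size forces the limit 1.\<close>
    proof (cases "\<exists>m \<sigma>. \<sigma> permutes {1..m} \<and> rich m \<sigma> \<and> models m \<sigma> \<phi>")
      case True
      then obtain m \<sigma> where *: "\<sigma> permutes {1..m}" "rich m \<sigma>" "models m \<sigma> \<phi>"
        by blast
      have "(\<lambda>n. ?P n (- {\<pi>. models n \<pi> \<phi>})) \<longlonglongrightarrow> 0"
      proof (rule lim0)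
        fix n \<pi> assume "\<pi> permutes {1..n}" "\<pi> \<in> - {\<pi>. models n \<pi> \<phi>}"
        then show "\<not> rich n \<pi>"
          using same[of \<pi> n \<sigma> m] * by blast
      qed
      then have "(\<lambda>n. 1 - ?P n (- {\<pi>. models n \<pi> \<phi>})) \<longlonglongrightarrow> 1 - 0"
        by (intro tendsto_diff tendsto_const)
      moreover have "1 - ?P n (- {\<pi>. models n \<pi> \<phi>}) = ?P n {\<pi>. models n \<pi> \<phi>}" for n
        using measure_pmf.prob_compl[of "{\<pi>. models n \<pi> \<phi>}" "mallows n q"] by (simp add: Compl_eq_Diff_UNIV)
      ultimately show ?thesis
        by simp
    next
      case False
      then have "(\<lambda>n. ?P n {\<pi>. models n \<pi> \<phi>}) \<longlonglongrightarrow> 0"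
        by (intro lim0) blast
      then show ?thesis
        by simp
    qed
  qed
  show ?thesis
    unfolding zero_one_law_def convergence_law_def
  proof (intro conjI allI impI)
    fix \<phi> assume "sentence \<phi>"
    then obtain x where x: "x \<in> {0, 1}" "(\<lambda>n. ?P n {\<pi>. models n \<pi> \<phi>}) \<longlonglongrightarrow> x"
      using limit by blast
    from x(2) show "convergent (\<lambda>n. ?P n {\<pi>. models n \<pi> \<phi>})"
      by (rule convergentI)
    from x show "lim (\<lambda>n. ?P n {\<pi>. models n \<pi> \<phi>}) \<in> {0, 1}"
      by (simp only: limI)
  qed
qed

end

section \<open>Reversal and the case \<open>q > 1\<close>\<close>

text \<open>The points moved by h pair up, one below its image and one above.\<close>

lemma even_card_involution:
  fixes h :: "'a :: linorder \<Rightarrow> 'a"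
  assumes "finite A" "\<And>x. x \<in> A \<Longrightarrow> h x \<in> A" "\<And>x. x \<in> A \<Longrightarrow> h (h x) = x"
  shows "even (card A) \<longleftrightarrow> even (card {x \<in> A. h x = x})"
proof -
  let ?L = "{x \<in> A. x < h x}" and ?G = "{x \<in> A. h x < x}" and ?F = "{x \<in> A. h x = x}"
  have "A = ?L \<union> ?G \<union> ?F"
    by auto
  moreover have "card (?L \<union> ?G \<union> ?F) = card ?L + card ?G + card ?F"
    using assms(1) by (subst card_Un_disjoint; (subst card_Un_disjoint)?) auto
  moreover have "bij_betw h ?L ?G"
    by (rule bij_betw_byWitness[where f' = h]) (use assms in auto)
  then have "card ?L = card ?G"
    by (rule bij_betw_same_card)
  ultimately show ?thesis
    by simp
qed

text \<open>Squaring h lowers k by one, and on the fixed points of the square h is an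
  involution.\<close>

lemma even_card_fixed_points:
  fixes h :: "'a :: linorder \<Rightarrow> 'a"
  assumes "finite A" "\<And>x. x \<in> A \<Longrightarrow> h x \<in> A" "\<And>x. x \<in> A \<Longrightarrow> (h ^^ (2 ^ k)) x = x"
  shows "even (card A) \<longleftrightarrow> even (card {x \<in> A. h x = x})"
  using assms(2,3)
proof (induction k arbitrary: h)
  case 0
  then have "{x \<in> A. h x = x} = A"
    by auto
  then show ?case by simp
next
  case (Suc k)
  have "even (card A) \<longleftrightarrow> even (card {x \<in> A. (h ^^ 2) x = x})"
  proof (rule Suc.IH)
    show "(h ^^ 2) x \<in> A" if "x \<in> A" for x
      using that Suc.prems(1) by (simp add: numeral_2_eq_2)
    show "((h ^^ 2) ^^ (2 ^ k)) x = x" if "x \<in> A" for x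
      using Suc.prems(2)[OF that] by (simp add: funpow_mult mult.commute)
  qed
  also have "\<dots> \<longleftrightarrow> even (card {x \<in> {x \<in> A. (h ^^ 2) x = x}. h x = x})"
    by (rule even_card_involution) (use assms(1) Suc.prems(1) in \<open>auto simp: numeral_2_eq_2\<close>)
  also have "{x \<in> {x \<in> A. (h ^^ 2) x = x}. h x = x} = {x \<in> A. h x = x}"
    by (auto simp: numeral_2_eq_2)
  finally show ?case .
qed

definition reversal :: "nat \<Rightarrow> nat \<Rightarrow> nat" where
  "reversal n x = (if x \<in> {0<..n} then Suc n - x else x)"

lemma reversal_reversal [simp]: "reversal n (reversal n x) = x"
  by (auto simp: reversal_def)

lemma reversal_comp_reversal [simp]: "reversal n \<circ> (reversal n \<circ> \<sigma>) = \<sigma>"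
  by (simp add: fun_eq_iff)

lemma reversal_permutes: "reversal n permutes {0<..n}"
  by (rule bij_imp_permutes[OF bij_betw_byWitness[where f' = "reversal n"]])
    (auto simp: reversal_def)

lemma reversal_less_iff: "x \<in> {0<..n} \<Longrightarrow> y \<in> {0<..n} \<Longrightarrow> reversal n x < reversal n y \<longleftrightarrow> y < x"
  by (auto simp: reversal_def)

text \<open>Every pair of positions is inverted by exactly one of the two permutations.\<close>

lemma inv_on_reversal_comp:
  assumes "\<sigma> permutes {0<..n}"
  shows "inv_on {0<..n} (reversal n \<circ> \<sigma>) + inv_on {0<..n} \<sigma> = card {(i, j). i \<in> {0<..n} \<and> j \<in> {0<..n} \<and> i < j}"
proof -
  let ?S = "\<lambda>\<pi>. {(i, j). i \<in> {0<..n} \<and> j \<in> {0<..n} \<and> i < j \<and> \<pi> i > (\<pi> j :: nat)}"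
  have fin: "finite (?S \<pi>)" for \<pi>
    by (rule finite_subset[of _ "{0<..n} \<times> {0<..n}"]) auto
  have rev: "?S (reversal n \<circ> \<sigma>) = {(i, j). i \<in> {0<..n} \<and> j \<in> {0<..n} \<and> i < j \<and> \<sigma> i < \<sigma> j}"
  proof -
    have "reversal n (\<sigma> j) < reversal n (\<sigma> i) \<longleftrightarrow> \<sigma> i < \<sigma> j" if "i \<in> {0<..n}" "j \<in> {0<..n}" for i j
      using that permutes_in_image[OF assms, of i] permutes_in_image[OF assms, of j]
      by (intro reversal_less_iff) simp_all
    then show ?thesis
      unfolding comp_apply by blast
  qed
  have "\<sigma> i < \<sigma> j \<or> \<sigma> j < \<sigma> i" if "i < j" for i j
    using that injD[OF permutes_inj[OF assms], of i j] by linarith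
  then have Un: "?S (reversal n \<circ> \<sigma>) \<union> ?S \<sigma> = {(i, j). i \<in> {0<..n} \<and> j \<in> {0<..n} \<and> i < j}"
    unfolding rev by blast
  have Int: "?S (reversal n \<circ> \<sigma>) \<inter> ?S \<sigma> = {}"
    unfolding rev by auto
  show ?thesis
    unfolding inv_on_def Un[symmetric] by (rule card_Un_disjoint[OF fin fin Int, symmetric])
qed

text \<open>Complementing the inversions replaces q by 1 / q up to a factor common to all
  permutations, which cancels in probabilities.\<close>

lemma weight_reversal:
  assumes "q > 0"
  shows "weight q {0<..n} E =
    q ^ card {(i, j). i \<in> {0<..n} \<and> j \<in> {0<..n} \<and> i < j} * weight (1 / q) {0<..n} {\<sigma>. reversal n \<circ> \<sigma> \<in> E}"
proof -
  let ?N = "card {(i, j). i \<in> {0<..n} \<and> j \<in> {0<..n} \<and> i < j}"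
  have perm: "reversal n \<circ> \<sigma> permutes {0<..n}" if "\<sigma> permutes {0<..n}" for \<sigma>
    using that reversal_permutes by (rule permutes_compose)
  have "weight q {0<..n} E = (\<Sum>\<sigma> | \<sigma> permutes {0<..n} \<and> reversal n \<circ> \<sigma> \<in> E. q ^ ?N * (1 / q) ^ inv_on {0<..n} \<sigma>)"
    unfolding weight_def
  proof (rule sum.reindex_bij_witness[of _ "\<lambda>\<sigma>. reversal n \<circ> \<sigma>" "\<lambda>\<pi>. reversal n \<circ> \<pi>"], goal_cases)
    case (5 \<pi>)
    then have "?N = inv_on {0<..n} \<pi> + inv_on {0<..n} (reversal n \<circ> \<pi>)"
      using inv_on_reversal_comp[of \<pi> n] by simp
    then show ?case
      using assms by (simp add: power_add field_simps)
  qed (use perm in auto)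
  then show ?thesis
    by (simp add: weight_def sum_distrib_left)
qed

lemma prob_reversal:
  assumes "q > 0"
  shows "measure_pmf.prob (mallows n q) E = measure_pmf.prob (mallows n (1 / q)) {\<sigma>. reversal n \<circ> \<sigma> \<in> E}"
  using assms weight_reversal[OF assms, of n E] weight_reversal[OF assms, of n UNIV]
  by (simp add: prob_mallows_weight)

text \<open>
  Outside the central interval, the reversal of a block permutation swaps the two sides, so all
  cycles there have even length. An odd power has no fixed points there, and the \<open>N\<close>-th power
  acts on the central interval with order a power of two.
\<close>

lemma fixed_points_reversal_block:
  assumes \<sigma>: "\<sigma> permutes {0<..n}" "\<sigma> \<in> block 0 a (n - a) n UNIV UNIV"
    and a: "a \<le> n - a" "n - 2 * a \<le> D" and N: "odd N" "fact D = N * 2 ^ k"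
  defines "F \<equiv> {x \<in> {0<..n}. ((reversal n \<circ> \<sigma>) ^^ N) x = x}"
  shows "card F \<le> D" "even (card F) \<longleftrightarrow> even n"
proof -
  define \<pi> where "\<pi> = reversal n \<circ> \<sigma>"
  define A I B where "A = {0<..a}" and "I = {a<..n - a}" and "B = {n - a<..n}"
  have le: "a \<le> n"
    using a by simp
  have decomp: "{0<..n} = A \<union> I \<union> B" "A \<inter> I = {}" "A \<inter> B = {}" "I \<inter> B = {}"
    using a by (auto simp: A_def I_def B_def)
  have \<pi>: "\<pi> permutes {0<..n}"
    unfolding \<pi>_def using \<sigma>(1) reversal_permutes by (rule permutes_compose)
  have \<sigma>AI: "\<sigma> ` A = A" "\<sigma> ` I = I"
    using \<sigma>(2) a by (simp_all add: mem_block_iff A_def I_def)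
  have "\<sigma> ` (A \<union> I) = A \<union> I"
    using \<sigma>AI by (simp add: image_Un)
  then have "\<sigma> ` ({0<..n} - (A \<union> I)) = {0<..n} - (A \<union> I)"
    using \<sigma>(1) permutes_image[OF \<sigma>(1)] by (intro image_Diff_permutes)
  moreover have "{0<..n} - (A \<union> I) = B"
    using decomp by auto
  ultimately have \<sigma>B: "\<sigma> ` B = B"
    by simp
  have "reversal n x \<in> B" if "x \<in> A" for x
    using that le by (auto simp: A_def B_def reversal_def)
  then have AB: "\<pi> x \<in> B" if "x \<in> A" for x
    using imageI[OF that, of \<sigma>] unfolding \<sigma>AI(1) \<pi>_def comp_apply .
  have "reversal n x \<in> A" if "x \<in> B" for x
    using that le by (auto simp: A_def B_def reversal_def)
  then have BA: "\<pi> x \<in> A" if "x \<in> B" for x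
    using imageI[OF that, of \<sigma>] unfolding \<sigma>B \<pi>_def comp_apply .
  have "reversal n x \<in> I" if "x \<in> I" for x
    using that le by (auto simp: I_def reversal_def)
  then have II: "\<pi> x \<in> I" if "x \<in> I" for x
    using imageI[OF that, of \<sigma>] unfolding \<sigma>AI(2) \<pi>_def comp_apply .
  have swap: "((\<pi> ^^ m) x \<in> A \<longleftrightarrow> (even m \<longleftrightarrow> x \<in> A)) \<and> (\<pi> ^^ m) x \<in> A \<union> B" if "x \<in> A \<union> B" for x m
  proof (induction m)
    case 0
    then show ?case using that by simp
  next
    case (Suc m)
    then show ?case
      using AB[of "(\<pi> ^^ m) x"] BA[of "(\<pi> ^^ m) x"] decomp(3) by auto
  qed
  have "(\<pi> ^^ N) x \<noteq> x" if "x \<in> A \<union> B" for x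
    using swap[OF that, of N] N(1) by auto
  then have F: "F = {x \<in> I. (\<pi> ^^ N) x = x}"
    unfolding F_def \<pi>_def[symmetric] decomp(1) by auto
  have pow: "(\<pi> ^^ m) x \<in> I" if "x \<in> I" for x m
    by (induction m) (use that II in auto)
  have cardI: "card I = n - 2 * a"
    by (simp add: I_def)
  have "card F \<le> card I"
    unfolding F by (intro card_mono) (auto simp: I_def)
  then show "card F \<le> D"
    using a(2) cardI by simp
  have "even (card I) \<longleftrightarrow> even (card {x \<in> I. (\<pi> ^^ N) x = x})"
  proof (rule even_card_fixed_points)
    fix x assume x: "x \<in> I"
    then show "(\<pi> ^^ N) x \<in> I"
      by (rule pow)
    \<comment> \<open>A cycle inside I has length at most D and so divides D! = N * 2 ^ k.\<close>
    have "set (support \<pi> x) \<subseteq> I"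
      using pow[OF x] by auto
    then have "card (set (support \<pi> x)) \<le> card I"
      by (intro card_mono) (auto simp: I_def)
    moreover have "card (set (support \<pi> x)) = least_power \<pi> x"
      using distinct_card[OF cycle_of_permutation[OF permutation_of_permutes[OF _ \<pi>]], of x] by simp
    ultimately have "least_power \<pi> x \<le> D"
      using cardI a(2) by simp
    then have "least_power \<pi> x dvd fact D"
      using least_power_pos[OF _ \<pi>, of x] by (intro dvd_fact) auto
    then have "(\<pi> ^^ fact D) x = x"
      using funpow_eq_self_iff[OF _ \<pi>] by simp
    then show "((\<pi> ^^ N) ^^ (2 ^ k)) x = x"
      unfolding N(2) by (simp add: funpow_mult)
  qed (simp add: I_def)
  moreover have "even (card I) \<longleftrightarrow> even n"
  proof -
    have "2 * a \<le> n"
      using a(1) by linarith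
    then show ?thesis
      by (simp add: cardI)
  qed
  ultimately show "even (card F) \<longleftrightarrow> even n"
    unfolding F by simp
qed

section \<open>A sentence for the parity of a bounded number of fixed points\<close>

lemma exists_odd_part:
  assumes "m > (0 :: nat)"
  shows "\<exists>N k. odd N \<and> m = N * 2 ^ k"
  using assms
proof (induction m rule: less_induct)
  case (less m)
  show ?case
  proof (cases "even m")
    case True
    then obtain m' where m': "m = 2 * m'" by blast
    then obtain N k where "odd N" "m' = N * 2 ^ k"
      using less.IH[of m'] less.prems by auto
    then show ?thesis
      using m' by (intro exI[of _ N] exI[of _ "Suc k"]) simp
  next
    case False
    then show ?thesis
      by (intro exI[of _ m] exI[of _ 0]) simp
  qed
qed

text \<open>Each step along the path gets its own variable, as the language has no function terms.
  The bound variables lie above x, so y \<le> x prevents the capture of y.\<close>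

primrec power_formula :: "nat \<Rightarrow> nat \<Rightarrow> nat \<Rightarrow> toob" where
  "power_formula 0 x y = Eq x y"
| "power_formula (Suc k) x y = Exists (Suc x) (Conj (Rel x (Suc x)) (power_formula k (Suc x) y))"

lemma free_vars_power_formula: "free_vars (power_formula k x y) \<subseteq> {x, y}"
proof (induction k arbitrary: x)
  case (Suc k)
  then show ?case
    using Suc.IH[of "Suc x"] by auto
qed simp

lemma sat_power_formula:
  assumes "\<And>x. x \<in> A \<Longrightarrow> f x \<in> A"
  shows "y \<le> x \<Longrightarrow> v x \<in> A \<Longrightarrow> sat A (\<lambda>i j. f i = j) v (power_formula k x y) \<longleftrightarrow> (f ^^ k) (v x) = v y"
proof (induction k arbitrary: x v)
  case (Suc k)
  have "sat A (\<lambda>i j. f i = j) v (power_formula (Suc k) x y) \<longleftrightarrow>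
      (\<exists>a\<in>A. f (v x) = a \<and> (f ^^ k) a = v y)"
    using Suc.IH[of "Suc x"] Suc.prems by (auto cong: bex_cong)
  also have "\<dots> \<longleftrightarrow> (f ^^ Suc k) (v x) = v y"
    using assms Suc.prems by (auto simp: funpow_swap1)
  finally show ?case .
qed simp

text \<open>A truth constant without free variables; it holds in the empty structure too.\<close>

definition true_formula :: toob where
  "true_formula = Neg (Exists 0 (Neg (Eq 0 0)))"

primrec apart_formula :: "nat \<Rightarrow> nat \<Rightarrow> toob" where
  "apart_formula x 0 = true_formula"
| "apart_formula x (Suc i) = Conj (Neg (Eq x i)) (apart_formula x i)"

lemma free_vars_apart_formula: "free_vars (apart_formula x i) \<subseteq> insert x {..<i}"
  by (induction i) (auto simp: true_formula_def)

lemma sat_apart_formula: "sat A R v (apart_formula x i) \<longleftrightarrow> v x \<notin> v ` {..<i}"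
  by (induction i) (auto simp: true_formula_def lessThan_Suc)

text \<open>The variables below j hold the points already chosen, from which k further fixed points
  of the N-th power must differ. For j = 0 it is a sentence.\<close>

primrec fixed_points_formula :: "nat \<Rightarrow> nat \<Rightarrow> nat \<Rightarrow> toob" where
  "fixed_points_formula N j 0 = true_formula"
| "fixed_points_formula N j (Suc k) = Exists j (Conj (power_formula N j j)
     (Conj (apart_formula j j) (fixed_points_formula N (Suc j) k)))"

lemma free_vars_fixed_points_formula: "free_vars (fixed_points_formula N j k) \<subseteq> {..<j}"
proof (induction k arbitrary: j)
  case (Suc k)
  then show ?case
    using Suc.IH[of "Suc j"] free_vars_power_formula[of N j j] free_vars_apart_formula[of j j]
    by (auto simp: lessThan_Suc)
qed (simp add: true_formula_def)

text \<open>Choosing one more point lowers the number of remaining ones by one, which matches the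
  recursion on k.\<close>

lemma sat_fixed_points_formula:
  fixes A :: "'a set"
  assumes f: "\<And>x. x \<in> A \<Longrightarrow> f x \<in> A" and A: "finite A"
  shows "sat A (\<lambda>i j. f i = j) v (fixed_points_formula N j k) \<longleftrightarrow>
    k \<le> card ({x \<in> A. (f ^^ N) x = x} - v ` {..<j})"
proof (induction k arbitrary: j v)
  case (Suc k)
  let ?F = "{x \<in> A. (f ^^ N) x = x} - v ` {..<j}"
  have nonempty_card: "(\<exists>a\<in>G. k \<le> card G - 1) \<longleftrightarrow> Suc k \<le> card G" if "finite G" for G :: "'a set"
  proof (cases "G = {}")
    case False
    then have "card G > 0" "\<exists>a. a \<in> G"
      using that by (auto simp: card_gt_0_iff)
    then show ?thesis
      by auto
  qed simp
  have img: "(v(j := a)) ` {..<Suc j} = insert a (v ` {..<j})" for a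
    by (auto simp: lessThan_Suc)
  have img': "(v(j := a)) ` {..<j} = v ` {..<j}" for a
    by auto
  have "sat A (\<lambda>i j. f i = j) v (fixed_points_formula N j (Suc k)) \<longleftrightarrow>
      (\<exists>a\<in>A. (f ^^ N) a = a \<and> a \<notin> v ` {..<j} \<and> k \<le> card ({x \<in> A. (f ^^ N) x = x} - insert a (v ` {..<j})))"
    unfolding fixed_points_formula.simps sat.simps sat_apart_formula Suc.IH img img'
    by (intro bex_cong refl) (simp add: sat_power_formula[where f = f, OF f])
  also have "\<dots> \<longleftrightarrow> (\<exists>a\<in>A. (f ^^ N) a = a \<and> a \<notin> v ` {..<j} \<and> k \<le> card (?F - {a}))"
    by (simp only: Diff_insert[of _ _ "v ` {..<j}"])
  also have "\<dots> \<longleftrightarrow> (\<exists>a\<in>?F. k \<le> card ?F - 1)"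
    using A by (auto simp: card_Diff_singleton)
  also have "\<dots> \<longleftrightarrow> Suc k \<le> card ?F"
    using A by (intro nonempty_card) simp
  finally show ?case .
qed (simp add: true_formula_def)

text \<open>A disjunction over the values 0, 2, ..., 2 * d, each expressed as at least i but not i +
  1, with disjunction written through negation and conjunction.\<close>

primrec even_fixed_points_formula :: "nat \<Rightarrow> nat \<Rightarrow> toob" where
  "even_fixed_points_formula N 0 = Neg (fixed_points_formula N 0 1)"
| "even_fixed_points_formula N (Suc d) = Neg (Conj (Neg (even_fixed_points_formula N d))
     (Neg (Conj (fixed_points_formula N 0 (2 * Suc d)) (Neg (fixed_points_formula N 0 (Suc (2 * Suc d)))))))"

lemma sentence_even_fixed_points_formula: "sentence (even_fixed_points_formula N d)"
proof -
  have "free_vars (fixed_points_formula N 0 k) = {}" for k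
    using free_vars_fixed_points_formula[of N 0 k] by simp
  then show ?thesis
    unfolding sentence_def by (induction d) (simp_all del: fixed_points_formula.simps)
qed

lemma models_even_fixed_points_formula:
  assumes "\<pi> permutes {1..n}"
  shows "models n \<pi> (even_fixed_points_formula N d) \<longleftrightarrow>
    even (card {x \<in> {1..n}. (\<pi> ^^ N) x = x}) \<and> card {x \<in> {1..n}. (\<pi> ^^ N) x = x} \<le> 2 * d"
    (is "_ \<longleftrightarrow> even ?c \<and> _")
proof -
  define c where "c = ?c"
  have "sat {1..n} (\<lambda>i j. \<pi> i = j) v (fixed_points_formula N 0 k) \<longleftrightarrow> k \<le> c" for v k
    unfolding c_def using sat_fixed_points_formula[of "{1..n}" \<pi> v N 0 k] permutes_in_image[OF assms] by simp
  then have "sat {1..n} (\<lambda>i j. \<pi> i = j) id (even_fixed_points_formula N d) \<longleftrightarrow> even c \<and> c \<le> 2 * d"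
  proof (induction d)
    case 0
    then show ?case by (auto simp: Suc_le_eq simp del: fixed_points_formula.simps)
  next
    case (Suc d)
    have "c \<le> 2 * Suc d \<longleftrightarrow> c \<le> 2 * d \<or> c = 2 * d + 1 \<or> c = 2 * Suc d"
      by auto
    then show ?case
      using Suc by (auto simp del: fixed_points_formula.simps)
  qed
  then show ?thesis
    using models_iff_sat[OF sentence_even_fixed_points_formula] unfolding c_def by blast
qed

text \<open>Outside an event of probability at most 1 / 4 the sentence holds exactly when n is even,
  so for large n its probabilities at consecutive n differ by at least 1 / 2.\<close>

lemma mallows_no_convergence_law:
  assumes q: "q > 1"
  shows "\<not> convergence_law (\<lambda>n. mallows n q)"
proof
  let ?q = "1 / q"
  have q': "0 < ?q" "?q < 1" "0 < q"
    using q by auto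
  obtain D where D: "\<forall>\<^sub>F n in sequentially. 1 - 1 / 4 \<le> measure_pmf.prob (mallows n ?q)
      {\<sigma>. \<exists>a. a \<le> n - a \<and> n - 2 * a \<le> D \<and> \<sigma> \<in> block 0 a (n - a) n UNIV UNIV}"
    using central_block[OF q'(1,2), of "1 / 4"] by auto
  obtain N k :: nat where N: "odd N" "fact D = N * 2 ^ k"
    using exists_odd_part[of "fact D"] by auto
  \<comment> \<open>The even values up to 2 * D are tested, which covers the bound D on the number
    of fixed points.\<close>
  define \<phi> where "\<phi> = even_fixed_points_formula N D"
  let ?P = "\<lambda>n. measure_pmf.prob (mallows n q) {\<pi>. models n \<pi> \<phi>}"
  let ?G = "\<lambda>n. {\<sigma>. \<exists>a. a \<le> n - a \<and> n - 2 * a \<le> D \<and> \<sigma> \<in> block 0 a (n - a) n UNIV UNIV}"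
  have good: "models n (reversal n \<circ> \<sigma>) \<phi> \<longleftrightarrow> even n" if "\<sigma> permutes {0<..n}" "\<sigma> \<in> ?G n" for n \<sigma>
  proof -
    from that(2) obtain a where a: "a \<le> n - a" "n - 2 * a \<le> D" "\<sigma> \<in> block 0 a (n - a) n UNIV UNIV"
      by blast
    have "reversal n \<circ> \<sigma> permutes {1..n}"
      using permutes_compose[OF that(1) reversal_permutes] by (simp add: atLeastSucAtMost_greaterThanAtMost)
    from models_even_fixed_points_formula[OF this, of N D]
    show ?thesis
      using fixed_points_reversal_block[OF that(1) a(3,1,2) N]
      by (simp add: \<phi>_def atLeastSucAtMost_greaterThanAtMost)
  qed
  have even_n: "measure_pmf.prob (mallows n ?q) (?G n) \<le> ?P n" if "even n" for n
    unfolding prob_reversal[OF q'(3), of n "{\<pi>. models n \<pi> \<phi>}"]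
    using good that q' by (intro prob_mallows_mono) auto
  have odd_n: "measure_pmf.prob (mallows n ?q) (?G n) \<le> 1 - ?P n" if "odd n" for n
  proof -
    have "measure_pmf.prob (mallows n ?q) (?G n) \<le> measure_pmf.prob (mallows n ?q) {\<sigma>. reversal n \<circ> \<sigma> \<in> - {\<pi>. models n \<pi> \<phi>}}"
      using good that q' by (intro prob_mallows_mono) auto
    also have "\<dots> = measure_pmf.prob (mallows n q) (- {\<pi>. models n \<pi> \<phi>})"
      by (rule prob_reversal[OF q'(3), symmetric])
    also have "\<dots> = 1 - ?P n"
      using measure_pmf.prob_compl[of "{\<pi>. models n \<pi> \<phi>}" "mallows n q"] by (simp add: Compl_eq_Diff_UNIV)
    finally show ?thesis .
  qed
  assume "convergence_law (\<lambda>n. mallows n q)"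
  then obtain L where L: "?P \<longlonglongrightarrow> L"
    using sentence_even_fixed_points_formula[of N D]
    by (auto simp: convergence_law_def convergent_def \<phi>_def)
  have "\<forall>\<^sub>F n in sequentially. \<bar>?P n - L\<bar> < 1 / 4"
    using tendstoD[OF L, of "1 / 4"] by (simp add: dist_real_def)
  with D have "\<forall>\<^sub>F n in sequentially. \<bar>?P n - L\<bar> < 1 / 4 \<and> 3 / 4 \<le> measure_pmf.prob (mallows n ?q) (?G n)"
    by eventually_elim auto
  then obtain n0 where n0: "\<And>n. n \<ge> n0 \<Longrightarrow> \<bar>?P n - L\<bar> < 1 / 4 \<and> 3 / 4 \<le> measure_pmf.prob (mallows n ?q) (?G n)"
    by (auto simp: eventually_sequentially)
  have "3 / 4 \<le> ?P (2 * n0)"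
    using n0[of "2 * n0"] even_n[of "2 * n0"] by (auto intro: order_trans)
  moreover have "3 / 4 \<le> 1 - ?P (Suc (2 * n0))"
    using n0[of "Suc (2 * n0)"] odd_n[of "Suc (2 * n0)"] by (auto intro: order_trans)
  moreover have "\<bar>?P (2 * n0) - L\<bar> < 1 / 4" "\<bar>?P (Suc (2 * n0)) - L\<bar> < 1 / 4"
    using n0[of "2 * n0"] n0[of "Suc (2 * n0)"] by auto
  ultimately show False
    by linarith
qed

theorem theorem1p1:
  fixes q :: real
  assumes "q > 0"
  shows "(q = 1 \<longrightarrow> convergence_law (\<lambda>n. mallows n q) \<and> \<not> zero_one_law (\<lambda>n. mallows n q)) \<and>
    (q < 1 \<longrightarrow> zero_one_law (\<lambda>n. mallows n q)) \<and>
    (q > 1 \<longrightarrow> \<not> convergence_law (\<lambda>n. mallows n q))"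
  using assms uniform_convergence_law uniform_not_zero_one_law mallows_zero_one_law mallows_no_convergence_law
  by auto

end
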